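(* (i) Let $S\equiv\pm\{1, 3, 4, 5, 7, 9, 11, 16, 17, 18, 19, 20\}\pmod{42}$ and $T\equiv\pm\{1, 2, 3, 7, 8, 11, 13, 15, 17, 18, 19, 20\}\pmod{42}$. Then $p(S,n)=p(T,n-1)$ for all $n\geq 1$. (ii) Let $S\equiv\pm\{1, 2, 5, 6, 7, 9, 10, 11, 13, 15, 16, 19\}\pmod{42}$ and $T\equiv\pm\{1, 3, 4, 5, 6, 7, 11, 13, 15, 16, 17, 20\}\pmod{42}$. Then $p(S,n)=p(T,n)$ for all integers $n\ge0$ with $n\neq 2$. (iii) Let $S\equiv\pm\{1, 3, 4, 5, 7, 9, 10, 11, 12, 17, 19, 20\}\pmod{42}$ and $T\equiv\pm\{1, 2, 5, 7, 8, 9, 10, 11, 12, 13, 15, 19\}\pmod{42}$. Then $p(S,n)=p(T,n)$ for all integers $n\ge0$ with $n\neq 2$. (iv) Let $S\equiv\pm\{2, 3, 5, 7, 8, 9, 10, 11, 13, 17, 18, 19\}\pmod{42}$ and $T\equiv\pm\{1, 3, 5, 7, 8, 11, 13, 15, 16, 17, 18, 20\}\pmod{42}$. Then $p(S,n)=p(T,n-2)$ for all $n\geq 2$. (v) Let $S\equiv\pm\{3, 4, 5, 7, 8, 9, 10, 11, 12, 13, 17, 19\}\pmod{42}$ and $T\equiv\pm\{1, 4, 5, 7, 9, 12, 13, 15, 16, 17, 19, 20\}\pmod{42}$. Then $p(S,n)=p(T,n-3)$ for all $n\geq 3$. (vi) Let $S\equiv\pm\{1, 2, 4, 5, 6, 7,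 9, 13, 15, 16, 17, 19\}\pmod{42}$ and $T\equiv\pm\{1, 2, 3, 6, 7, 8, 10, 11, 13, 15, 17, 19\}\pmod{42}$. Then $p(S,n)=p(T,n)$ for all integers $n\ge0$ with $n\neq 3$.
   Context: For a set $S$ of positive integers and an integer $n\ge 0$, $p(S,n)$ denotes the number of partitions of $n$ into parts belonging to $S$ (so $p(S,0)=1$). The notation $S\equiv\pm\{r_1,\dots,r_k\}\pmod M$ means that $S$ is the set of all positive integers $n$ such that $n\equiv r_i$ or $n\equiv -r_i\pmod M$ for some $i$. *)

theory Defs
  imports "HOL-Library.Multiset" "HOL-Number_Theory.Cong"
begin

text \<open>
  A partition of \<open>n\<close> into parts from \<open>S\<close> is a finite multiset of elements of \<open>S\<close> with sum \<open>n\<close>.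
  The definition is meant for sets \<open>S\<close> of positive integers, for which there are only finitely
  many such multisets.
\<close>

definition partitions_into :: "nat set \<Rightarrow> nat \<Rightarrow> nat multiset set" where
  "partitions_into S n = {P. set_mset P \<subseteq> S \<and> sum_mset P = n}"

definition partition_count :: "nat set \<Rightarrow> nat \<Rightarrow> nat" where
  "partition_count S n = card (partitions_into S n)"

definition pm_residues :: "int set \<Rightarrow> int \<Rightarrow> nat set" where
  "pm_residues R M = {n. n > 0 \<and> (\<exists>r\<in>R. [int n = r] (mod M) \<or> [int n = - r] (mod M))}"

end

theory Submission
  imports Defs "HOL-Analysis.Infinite_Sum" "HOL-Analysis.Infinite_Products"
    "HOL-Analysis.Uniform_Limit"
begin

text \<open>
  For \<open>0 < q < 1\<close> put \<open>T\<^sub>r = \<Prod>\<^bsub>n\<ge>0\<^esub> (1 - q\<^bsup>42n+r\<^esup>) (1 - q\<^bsup>42n+42-r\<^esup>)\<close>, so that \<open>1 / \<Prod>\<^bsub>r\<in>R\<^esub> T\<^sub>r\<close>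
  generates the partitions into parts from \<open>\<plusminus>R\<close>. Let \<open>\<theta>(r)\<close> be \<open>T\<^sub>r\<close> times the power of \<open>q\<close> that
  makes it odd and antiperiodic in \<open>r\<close>. Part (i) then says \<open>1 / \<Prod>\<^bsub>r\<in>S\<^esub> \<theta>(r) - 1 / \<Prod>\<^bsub>r\<in>T\<^esub> \<theta>(r) = 1\<close>.
  Replacing \<open>\<theta>(r)\<close> by \<open>\<theta>(k r)\<close> with \<open>k\<close> a unit modulo 42 permutes the six parts (\<open>k = 1, 5, 11, 13,
  17, 19\<close>, with \<open>S\<close> and \<open>T\<close> exchanged for \<open>11\<close> and \<open>19\<close>), so it suffices to prove this identity for
  all such \<open>k\<close> at once.

  The identity combines three instances of the Weierstrass three-term relation: two in base \<open>q\<^bsup>42\<^esup>\<close>,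
  and one in base \<open>q\<^bsup>21\<^esup>\<close> with some arguments negated. Writing \<open>[x; q] = \<Prod>\<^bsub>n\<ge>0\<^esub> (1 - x q\<^sup>n) (1 -
  q\<^bsup>n+1\<^esup> / x)\<close>, the two bases are linked by \<open>[x; q\<^sup>2] [q x; q\<^sup>2] = [x; q]\<close> and \<open>[x; q] [-x; q] =
  [x\<^sup>2; q\<^sup>2]\<close>. The three-term relation is a Pluecker relation: by the Jacobi triple product, \<open>[x y;
  q] [x / y; q]\<close> is a 2 by 2 determinant \<open>x (P(x) Q(y) - P(y) Q(x))\<close>.
\<close>

subsection \<open>The Jacobi triple product\<close>

definition qpochhammer :: "'a::comm_ring_1 \<Rightarrow> 'a \<Rightarrow> nat \<Rightarrow> 'a" where
  "qpochhammer a q n = (\<Prod>k<n. 1 - a * q ^ k)"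

definition qpochhammer_inf :: "'a::{real_normed_field,banach} \<Rightarrow> 'a \<Rightarrow> 'a" where
  "qpochhammer_inf a q = (\<Prod>k. 1 - a * q ^ k)"

lemma qpochhammer_0 [simp]: "qpochhammer a q 0 = 1"
  by (simp add: qpochhammer_def)

lemma qpochhammer_Suc: "qpochhammer a q (Suc n) = qpochhammer a q n * (1 - a * q ^ n)"
  by (simp add: qpochhammer_def)

lemma qpochhammer_add: "qpochhammer a q (m + n) = qpochhammer a q m * qpochhammer (a * q ^ m) q n"
  by (induction n) (simp_all add: qpochhammer_Suc power_add mult_ac)

lemma convergent_prod_one_minus_geometric:
  fixes a q :: "'a::{real_normed_field,banach}"
  assumes "norm q < 1"
  shows "convergent_prod (\<lambda>k. 1 - a * q ^ k)"
proof -
  have "summable (\<lambda>k. norm a * norm q ^ k)"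
    using assms by (intro summable_mult summable_geometric) simp
  then have "summable (\<lambda>k. norm ((1 - a * q ^ k) - 1))"
    by (simp add: norm_mult norm_power)
  then show ?thesis
    by (intro abs_convergent_prod_imp_convergent_prod summable_imp_abs_convergent_prod)
qed

lemma qpochhammer_tendsto:
  fixes a q :: "'a::{real_normed_field,banach}"
  assumes "norm q < 1"
  shows "qpochhammer a q \<longlonglongrightarrow> qpochhammer_inf a q"
  using has_prod_imp_tendsto'[OF convergent_prod_has_prod[OF convergent_prod_one_minus_geometric[OF assms]]]
  by (simp add: qpochhammer_def[abs_def] qpochhammer_inf_def)

lemma qpochhammer_inf_unfold:
  fixes a q :: "'a::{real_normed_field,banach}"
  assumes "norm q < 1"
  shows "qpochhammer_inf a q = (1 - a) * qpochhammer_inf (a * q) q"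
  using has_prod_ignore_initial_segment'[OF convergent_prod_one_minus_geometric[OF assms], of a 1]
  by (simp add: qpochhammer_inf_def has_prod_iff mult_ac)

lemma one_minus_geometric_nonzero:
  fixes a q :: "'a::real_normed_field"
  assumes "norm a < 1" "norm q < 1"
  shows "1 - a * q ^ k \<noteq> 0"
proof -
  have "norm a * norm q ^ k \<le> norm a"
    using assms by (intro mult_left_le power_le_one) auto
  then have "norm (a * q ^ k) < norm (1::'a)"
    using assms by (simp add: norm_mult norm_power)
  then show ?thesis
    by auto
qed

lemma qpochhammer_nonzero:
  fixes a q :: "'a::real_normed_field"
  assumes "norm a < 1" "norm q < 1"
  shows "qpochhammer a q n \<noteq> 0"
  using one_minus_geometric_nonzero[OF assms] by (simp add: qpochhammer_def)

lemma qpochhammer_inf_nonzero: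
  fixes a q :: "'a::{real_normed_field,banach}"
  assumes "norm a < 1" "norm q < 1"
  shows "qpochhammer_inf a q \<noteq> 0"
  unfolding qpochhammer_inf_def
  using convergent_prod_one_minus_geometric[OF assms(2)] one_minus_geometric_nonzero[OF assms]
  by (rule prodinf_nonzero)

definition gauss_binomial :: "'a::field \<Rightarrow> nat \<Rightarrow> nat \<Rightarrow> 'a" where
  "gauss_binomial q m j =
    (if j \<le> m then qpochhammer q q m / (qpochhammer q q j * qpochhammer q q (m - j)) else 0)"

lemma gauss_binomial_eq_0 [simp]: "m < j \<Longrightarrow> gauss_binomial q m j = 0"
  by (simp add: gauss_binomial_def)

lemma gauss_binomial_0 [simp]:
  fixes q :: "'a::real_normed_field"
  shows "norm q < 1 \<Longrightarrow> gauss_binomial q m 0 = 1"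
  by (simp add: gauss_binomial_def qpochhammer_nonzero)

lemma gauss_binomial_Suc_Suc:
  fixes q :: "'a::real_normed_field"
  assumes q: "norm q < 1" and "j \<le> m"
  shows "gauss_binomial q (Suc m) (Suc j) =
    gauss_binomial q m (Suc j) + q ^ (m - j) * gauss_binomial q m j"
proof (cases "j = m")
  case True
  then show ?thesis
    by (simp add: gauss_binomial_def qpochhammer_nonzero q)
next
  case False
  with \<open>j \<le> m\<close> obtain d where m: "m = Suc (j + d)"
    by (metis le_neq_implies_less less_imp_Suc_add)
  have nz: "qpochhammer q q i \<noteq> 0" "1 - q * q ^ i \<noteq> 0" for i
    using q by (auto simp only: qpochhammer_nonzero one_minus_geometric_nonzero)
  have "qpochhammer q q (Suc m) / (qpochhammer q q (Suc j) * qpochhammer q q (Suc d)) =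
      qpochhammer q q m / (qpochhammer q q (Suc j) * qpochhammer q q d) +
      q ^ Suc d * (qpochhammer q q m / (qpochhammer q q j * qpochhammer q q (Suc d)))"
  proof -
    have factor: "1 - q * q ^ m = (1 - q * q ^ d) + q ^ Suc d * (1 - q * q ^ j)"
      by (simp add: m algebra_simps power_add)
    show ?thesis
      unfolding qpochhammer_Suc[of q q m] qpochhammer_Suc[of q q j] qpochhammer_Suc[of q q d] factor
      using nz[of j] nz[of d] by (simp add: add_divide_distrib distrib_left mult_ac del: power_Suc)
  qed
  then show ?thesis
    by (simp add: gauss_binomial_def m Suc_diff_le)
qed

theorem q_binomial_theorem:
  fixes q x :: "'a::real_normed_field"
  assumes q: "norm q < 1"
  shows "qpochhammer x q m = (\<Sum>j\<le>m. gauss_binomial q m j * (q ^ (j choose 2) * (- x) ^ j))"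
proof (induction m)
  case 0
  then show ?case using q by (simp add: numeral_2_eq_2)
next
  case (Suc m)
  let ?t = "\<lambda>m j. gauss_binomial q m j * (q ^ (j choose 2) * (- x) ^ j)"
  have pascal: "?t (Suc m) (Suc j) = ?t m (Suc j) - x * q ^ m * ?t m j" if "j \<le> m" for j
  proof -
    have "q ^ (m - j) * q ^ (Suc j choose 2) = q ^ m * q ^ (j choose 2)"
      using that by (simp add: numeral_2_eq_2 flip: power_add)
    then show ?thesis
      unfolding gauss_binomial_Suc_Suc[OF q that] by (simp add: algebra_simps)
  qed
  have split_head: "(\<Sum>j\<le>Suc m. ?t l j) = 1 + (\<Sum>j\<le>m. ?t l (Suc j))" for l
    using q by (subst sum.atMost_Suc_shift) (simp add: numeral_2_eq_2)
  have "(\<Sum>j\<le>Suc m. ?t (Suc m) j) = (1 + (\<Sum>j\<le>m. ?t m (Suc j))) - x * q ^ m * (\<Sum>j\<le>m. ?t m j)"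
    unfolding split_head using pascal by (simp add: sum_subtractf sum_distrib_left)
  also have "\<dots> = (\<Sum>j\<le>m. ?t m j) - x * q ^ m * (\<Sum>j\<le>m. ?t m j)"
    unfolding split_head[symmetric] by simp
  finally show ?case
    using Suc.IH by (simp add: qpochhammer_Suc algebra_simps)
qed

definition theta_prod :: "'a::{real_normed_field,banach} \<Rightarrow> 'a \<Rightarrow> 'a" where
  "theta_prod q x = qpochhammer_inf x q * qpochhammer_inf (q / x) q"

definition theta_term :: "'a::field \<Rightarrow> 'a \<Rightarrow> int \<Rightarrow> 'a" where
  "theta_term q x n = (- x) powi n * q powi (n * (n - 1) div 2)"

lemma theta_term_0 [simp]: "theta_term q x 0 = 1"
  by (simp add: theta_term_def)

lemma theta_term_plus_one:
  assumes "q \<noteq> 0" "x \<noteq> 0"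
  shows "theta_term q x (n + 1) = - x * q powi n * theta_term q x n"
proof -
  have "(n + 1) * (n + 1 - 1) div 2 = (n + n * (n - 1) div 2)"
    by (simp add: algebra_simps)
  then show ?thesis
    using assms by (simp add: theta_term_def power_int_add)
qed

lemma theta_term_times_qpochhammer:
  assumes q: "q \<noteq> 0" and x: "x \<noteq> 0"
  shows "theta_term q x (- int N) * qpochhammer (x / q ^ N) q N = qpochhammer (q / x) q N"
proof (induction N)
  case (Suc N)
  let ?c = "q ^ Suc N / x"
  have theta_step: "theta_term q x (- int (Suc N)) = - ?c * theta_term q x (- int N)"
    using theta_term_plus_one[OF assms, of "- int (Suc N)"] assms
    unfolding power_int_minus power_int_of_nat by (simp add: field_simps)
  have prod_step: "qpochhammer (x / q ^ Suc N) q (Suc N) = (1 - x / q ^ Suc N) * qpochhammer (x / q ^ N) q N"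
    using qpochhammer_add[of "x / q ^ Suc N" q 1 N] q by (simp add: qpochhammer_def)
  have "theta_term q x (- int (Suc N)) * qpochhammer (x / q ^ Suc N) q (Suc N) =
      (- ?c * (1 - x / q ^ Suc N)) * (theta_term q x (- int N) * qpochhammer (x / q ^ N) q N)"
    unfolding theta_step prod_step by (simp only: mult_ac)
  also have "- ?c * (1 - x / q ^ Suc N) = 1 - q / x * q ^ N"
    using assms by (simp add: field_simps)
  finally show ?case
    unfolding Suc.IH by (simp only: qpochhammer_Suc mult.commute)
qed simp

theorem finite_jacobi_triple_product:
  fixes q x :: "'a::real_normed_field"
  assumes q: "norm q < 1" "q \<noteq> 0" and x: "x \<noteq> 0"
  shows "qpochhammer x q N * qpochhammer (q / x) q N =
    (\<Sum>n = - int N..int N. gauss_binomial q (2 * N) (nat (int N + n)) * theta_term q x n)"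
proof -
  have shifted_term: "theta_term q x (- int N) * (q ^ (j choose 2) * (- (x / q ^ N)) ^ j) =
      theta_term q x (int j - int N)" for j
  proof (induction j)
    case (Suc j)
    have "theta_term q x (int (Suc j) - int N) =
        - x * q powi (int j - int N) * theta_term q x (int j - int N)"
      using theta_term_plus_one[OF q(2) x, of "int j - int N"] by (simp add: algebra_simps)
    also have "q powi (int j - int N) = q ^ j / q ^ N"
      using q by (simp add: power_int_diff)
    finally show ?case
      unfolding Suc.IH[symmetric] by (simp add: numeral_2_eq_2 power_add)
  qed (simp add: numeral_2_eq_2)
  have "qpochhammer x q N * qpochhammer (q / x) q N =
      theta_term q x (- int N) * qpochhammer (x / q ^ N) q (N + N)"
    using q(2) by (simp add: qpochhammer_add flip: theta_term_times_qpochhammer[OF q(2) x, of N])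
  also have "\<dots> = (\<Sum>j\<le>2 * N. gauss_binomial q (2 * N) j * theta_term q x (int j - int N))"
    unfolding q_binomial_theorem[OF q(1)] mult_2[symmetric] sum_distrib_left
    by (simp add: mult.left_commute flip: shifted_term)
  also have "\<dots> = (\<Sum>n = - int N..int N. gauss_binomial q (2 * N) (nat (int N + n)) * theta_term q x n)"
    by (rule sum.reindex_bij_witness[of _ "\<lambda>n. nat (int N + n)" "\<lambda>j. int j - int N"]) auto
  finally show ?thesis .
qed

lemma has_sum_tannery:
  fixes f :: "nat \<Rightarrow> 'i \<Rightarrow> 'a::{real_normed_algebra,banach}"
  assumes A: "countable A" "infinite A"
    and sums: "\<And>N. (f N has_sum s N) A" and lim_sums: "s \<longlonglongrightarrow> S"
    and lim: "\<And>i. i \<in> A \<Longrightarrow> (\<lambda>N. f N i) \<longlonglongrightarrow> g i"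
    and bound: "\<And>N i. i \<in> A \<Longrightarrow> norm (f N i) \<le> h i" and "h summable_on A"
  shows "(g has_sum S) A"
proof -
  obtain e :: "nat \<Rightarrow> 'i" where e: "bij_betw e UNIV A"
    using bij_betw_from_nat_into[OF A] by blast
  then have e_in: "e k \<in> A" for k
    by (auto simp: bij_betw_def)
  have "summable (\<lambda>k. h (e k))"
    using \<open>h summable_on A\<close> summable_on_reindex_bij_betw[OF e, of h] by (simp add: summable_on_imp_summable)
  moreover have "eventually (\<lambda>(k, N). norm (f N (e k)) \<le> h (e k)) (at_top \<times>\<^sub>F sequentially)"
    using bound e_in by (simp add: case_prod_unfold)
  ultimately have tannery: "summable (\<lambda>k. norm (g (e k)))" "(\<lambda>N. \<Sum>k. f N (e k)) \<longlonglongrightarrow> (\<Sum>k. g (e k))"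
    using tannerys_theorem[of "\<lambda>k N. f N (e k)" "\<lambda>k. g (e k)" sequentially "\<lambda>k. h (e k)"]
      lim e_in by simp_all
  have "(\<lambda>k. f N (e k)) sums s N" for N
    using sums[of N] has_sum_reindex_bij_betw[OF e, of "f N"] by (simp add: has_sum_imp_sums)
  then have "(\<Sum>k. f N (e k)) = s N" for N
    by (simp add: sums_iff)
  with tannery(2) lim_sums have "(\<Sum>k. g (e k)) = S"
    by (simp add: LIMSEQ_unique)
  with tannery(1) have "((\<lambda>k. g (e k)) has_sum S) UNIV"
    by (intro norm_summable_imp_has_sum) (simp_all add: sums_iff summable_norm_cancel)
  then show ?thesis
    unfolding has_sum_reindex_bij_betw[OF e] .
qed

lemma abs_summable_theta_term_int:
  fixes q x :: "'a::{real_normed_field,banach}"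
  assumes q: "norm q < 1" "q \<noteq> 0" and x: "x \<noteq> 0"
  shows "(\<lambda>n. theta_term q x n) abs_summable_on range int"
proof -
  have "(\<lambda>n. norm x * norm q ^ n) \<longlonglongrightarrow> norm x * 0"
    using q by (intro tendsto_mult tendsto_const LIMSEQ_realpow_zero) auto
  then have "eventually (\<lambda>n. norm x * norm q ^ n < 1 / 2) sequentially"
    by (rule order_tendstoD) simp
  then obtain N where N: "norm x * norm q ^ n < 1 / 2" if "n \<ge> N" for n
    by (auto simp: eventually_sequentially)
  have "summable (\<lambda>n. norm (theta_term q x (int n)))"
  proof (rule summable_ratio_test[of "1 / 2" N])
    fix n assume "N \<le> n"
    have "norm (theta_term q x (int (Suc n))) = norm x * norm q ^ n * norm (theta_term q x (int n))"
      using theta_term_plus_one[OF q(2) x, of "int n"] by (simp add: norm_mult norm_power add.commute)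
    also have "\<dots> \<le> 1 / 2 * norm (theta_term q x (int n))"
      using N[OF \<open>N \<le> n\<close>] by (intro mult_right_mono) auto
    finally show "norm (norm (theta_term q x (int (Suc n)))) \<le> 1 / 2 * norm (norm (theta_term q x (int n)))"
      by simp
  qed simp
  then show ?thesis
    by (simp add: summable_on_reindex o_def norm_summable_imp_summable_on)
qed

lemma theta_term_uminus:
  assumes "q \<noteq> 0" "x \<noteq> 0"
  shows "theta_term q x (- n) = theta_term q (q / x) n"
proof -
  have "- n * (- n - 1) div 2 = n + n * (n - 1) div 2"
    by (simp add: algebra_simps)
  then show ?thesis
    using assms by (simp add: theta_term_def power_int_add power_int_minus power_int_divide_distrib
        power_int_minus_left inverse_eq_divide)
qed

lemma abs_summable_theta_term:
  fixes q x :: "'a::{real_normed_field,banach}"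
  assumes q: "norm q < 1" "q \<noteq> 0" and x: "x \<noteq> 0"
  shows "(\<lambda>n. theta_term q x n) abs_summable_on UNIV"
proof -
  have "(\<lambda>n. theta_term q x (- n)) abs_summable_on range int"
    using abs_summable_theta_term_int[OF q, of "q / x"] q x by (simp add: theta_term_uminus)
  then have "theta_term q x abs_summable_on uminus ` range int"
    by (subst summable_on_reindex) (simp_all add: o_def)
  then have "theta_term q x abs_summable_on range int \<union> uminus ` range int"
    by (intro summable_on_union abs_summable_theta_term_int assms)
  also have "range int \<union> uminus ` range int = UNIV"
    by (auto simp: image_iff) (metis int_cases2)
  finally show ?thesis .
qed

lemma gauss_binomial_bounded:
  fixes q :: "'a::{real_normed_field,banach}"
  assumes q: "norm q < 1"
  obtains K where "\<And>m j. norm (gauss_binomial q m j) \<le> K"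
proof -
  have lim: "qpochhammer q q \<longlonglongrightarrow> qpochhammer_inf q q"
    by (rule qpochhammer_tendsto[OF q])
  then obtain B where B: "norm (qpochhammer q q n) \<le> B" for n
    by (metis BseqE convergentI convergent_imp_Bseq)
  from lim have "(\<lambda>n. inverse (qpochhammer q q n)) \<longlonglongrightarrow> inverse (qpochhammer_inf q q)"
    by (intro tendsto_inverse qpochhammer_inf_nonzero q)
  then obtain B' where B': "norm (inverse (qpochhammer q q n)) \<le> B'" for n
    by (metis BseqE convergentI convergent_imp_Bseq)
  have "norm (gauss_binomial q m j) \<le> B * (B' * B')" for m j
  proof -
    have "0 \<le> B" "0 \<le> B'"
      using B B' norm_ge_zero order_trans by blast+
    then have "norm (qpochhammer q q m) * (norm (inverse (qpochhammer q q j)) *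
        norm (inverse (qpochhammer q q (m - j)))) \<le> B * (B' * B')"
      by (intro mult_mono B B') auto
    then show ?thesis
      using \<open>0 \<le> B\<close> \<open>0 \<le> B'\<close>
      by (simp add: gauss_binomial_def divide_inverse norm_mult norm_inverse)
  qed
  then show ?thesis
    by (rule that)
qed

lemma central_gauss_binomial_tendsto:
  fixes q :: "'a::{real_normed_field,banach}"
  assumes q: "norm q < 1"
  shows "(\<lambda>N. gauss_binomial q (2 * N) (nat (int N + n))) \<longlonglongrightarrow> 1 / qpochhammer_inf q q"
proof -
  let ?P = "qpochhammer q q" and ?L = "qpochhammer_inf q q"
  have at_top: "filterlim (\<lambda>N. nat (int N + c)) at_top sequentially" for c
    unfolding filterlim_at_top
  proof
    fix Z show "eventually (\<lambda>N. Z \<le> nat (int N + c)) sequentially"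
      using eventually_ge_at_top[of "nat (int Z + \<bar>c\<bar>)"] by eventually_elim auto
  qed
  have lim: "(\<lambda>N. ?P (nat (int N + c))) \<longlonglongrightarrow> ?L" for c
    using filterlim_compose[OF qpochhammer_tendsto[OF q] at_top] .
  have "(\<lambda>N. ?P (2 * N)) \<longlonglongrightarrow> ?L"
    by (rule filterlim_compose[OF qpochhammer_tendsto[OF q]])
      (auto intro!: filterlim_subseq simp: strict_mono_def)
  then have "(\<lambda>N. ?P (2 * N) / (?P (nat (int N + n)) * ?P (nat (int N + - n)))) \<longlonglongrightarrow> ?L / (?L * ?L)"
    using qpochhammer_inf_nonzero[OF q q] by (intro tendsto_intros lim) auto
  moreover have "eventually (\<lambda>N. ?P (2 * N) / (?P (nat (int N + n)) * ?P (nat (int N + - n))) =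
      gauss_binomial q (2 * N) (nat (int N + n))) sequentially"
    using eventually_ge_at_top[of "nat \<bar>n\<bar>"]
  proof eventually_elim
    case (elim N)
    then have "2 * N - nat (int N + n) = nat (int N + - n)" "nat (int N + n) \<le> 2 * N"
      by auto
    then show ?case
      by (simp add: gauss_binomial_def)
  qed
  ultimately show ?thesis
    using qpochhammer_inf_nonzero[OF q q] by (simp add: tendsto_cong)
qed

theorem jacobi_triple_product:
  fixes q x :: "'a::{real_normed_field,banach}"
  assumes q: "norm q < 1" "q \<noteq> 0" and x: "x \<noteq> 0"
  shows "(theta_term q x has_sum (qpochhammer_inf q q * theta_prod q x)) UNIV"
proof -
  define c where "c N n = (if n \<in> {- int N..int N} then gauss_binomial q (2 * N) (nat (int N + n)) else 0)"
    for N n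
  obtain K where K: "norm (gauss_binomial q m j) \<le> K" for m j
    using gauss_binomial_bounded[OF q(1)] by blast
  then have "0 \<le> K"
    using norm_ge_zero order_trans by blast
  have "((\<lambda>n. 1 / qpochhammer_inf q q * theta_term q x n) has_sum theta_prod q x) UNIV"
  proof (rule has_sum_tannery[where f = "\<lambda>N n. c N n * theta_term q x n"])
    show "((\<lambda>n. c N n * theta_term q x n) has_sum (qpochhammer x q N * qpochhammer (q / x) q N)) UNIV" for N
      unfolding finite_jacobi_triple_product[OF assms]
      by (rule has_sum_finite_neutralI[of "{- int N..int N}"]) (auto simp: c_def)
    show "(\<lambda>N. qpochhammer x q N * qpochhammer (q / x) q N) \<longlonglongrightarrow> theta_prod q x"
      unfolding theta_prod_def by (intro tendsto_mult qpochhammer_tendsto q)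
    show "(\<lambda>N. c N n * theta_term q x n) \<longlonglongrightarrow> 1 / qpochhammer_inf q q * theta_term q x n" for n
    proof (intro tendsto_mult tendsto_const
        Lim_transform_eventually[OF central_gauss_binomial_tendsto[OF q(1)]])
      show "eventually (\<lambda>N. gauss_binomial q (2 * N) (nat (int N + n)) = c N n) sequentially"
        using eventually_ge_at_top[of "nat \<bar>n\<bar>"] by eventually_elim (auto simp: c_def)
    qed
    show "norm (c N n * theta_term q x n) \<le> K * norm (theta_term q x n)" for N n
      unfolding norm_mult using K \<open>0 \<le> K\<close> by (intro mult_right_mono) (auto simp: c_def)
    show "(\<lambda>n. K * norm (theta_term q x n)) summable_on UNIV"
      by (intro summable_on_cmult_right abs_summable_theta_term assms)
  qed (auto simp: infinite_UNIV_char_0)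
  from has_sum_cmult_right[OF this, of "qpochhammer_inf q q"] show ?thesis
    using qpochhammer_inf_nonzero[OF q(1) q(1)] by simp
qed

subsection \<open>The Weierstrass three-term relation\<close>

definition theta_sum :: "'a::{real_normed_field,banach} \<Rightarrow> 'a \<Rightarrow> 'a" where
  "theta_sum q x = qpochhammer_inf q q * theta_prod q x"

lemma has_sum_theta_term:
  fixes q x :: "'a::{real_normed_field,banach}"
  shows "norm q < 1 \<Longrightarrow> q \<noteq> 0 \<Longrightarrow> x \<noteq> 0 \<Longrightarrow> (theta_term q x has_sum theta_sum q x) UNIV"
  unfolding theta_sum_def by (rule jacobi_triple_product)

lemma has_sum_product:
  fixes f :: "'i \<Rightarrow> 'a::{real_normed_field,banach}"
  assumes f: "(f has_sum a) A" "f abs_summable_on A" and g: "(g has_sum b) B" "g abs_summable_on B"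
  shows "((\<lambda>(i, j). f i * g j) has_sum (a * b)) (A \<times> B)"
proof (rule has_sum_SigmaI)
  show "((\<lambda>j. case (i, j) of (i, j) \<Rightarrow> f i * g j) has_sum f i * b) B" for i
    using has_sum_cmult_right[OF g(1)] by simp
  show "((\<lambda>i. f i * b) has_sum a * b) A"
    by (rule has_sum_cmult_left[OF f(1)])
  have "(\<lambda>(i, j). f i * g j) abs_summable_on A \<times> B"
    unfolding abs_summable_on_Sigma_iff
    using summable_on_cmult_right[OF g(2)] summable_on_cmult_left[OF f(2)]
    by (simp add: norm_mult infsum_cmult_right' abs_mult abs_of_nonneg infsum_nonneg)
  then show "(\<lambda>(i, j). f i * g j) summable_on A \<times> B"
    by (rule abs_summable_summable)
qed

lemma has_sum_int_pairs_parity: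
  fixes f :: "int \<Rightarrow> int \<Rightarrow> 'a::topological_comm_monoid_add"
  assumes "((\<lambda>(i, j). f (i + j) (i - j)) has_sum a) UNIV"
    and "((\<lambda>(i, j). f (i + j) (i - j + 1)) has_sum b) UNIV"
  shows "((\<lambda>(m, n). f m n) has_sum (a + b)) UNIV"
proof -
  have "bij_betw (\<lambda>(i, j). (i + j, i - j)) UNIV {(m, n). even (m + n :: int)}"
    by (rule bij_betw_byWitness[where f' = "\<lambda>(m, n). ((m + n) div 2, m - (m + n) div 2)"]) auto
  from has_sum_reindex_bij_betw[OF this, of "\<lambda>(m, n). f m n"] assms(1)
  have even: "((\<lambda>(m, n). f m n) has_sum a) {(m, n). even (m + n)}"
    by (simp add: case_prod_unfold)
  have "bij_betw (\<lambda>(i, j). (i + j, i - j + 1)) UNIV {(m, n). odd (m + n :: int)}"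
    by (rule bij_betw_byWitness[where f' = "\<lambda>(m, n). ((m + n) div 2, m - (m + n) div 2)"])
      (auto, presburger)
  from has_sum_reindex_bij_betw[OF this, of "\<lambda>(m, n). f m n"] assms(2)
  have odd: "((\<lambda>(m, n). f m n) has_sum b) {(m, n). odd (m + n)}"
    by (simp add: case_prod_unfold)
  have "{(m, n). even (m + n)} \<union> {(m, n). odd (m + n :: int)} = UNIV"
    by auto
  with has_sum_Un_disjoint[OF even odd] show ?thesis
    by auto
qed

lemma theta_term_square:
  assumes "q \<noteq> 0"
  shows "theta_term (q^2) (- (x^2)) i = x powi (2 * i) * q powi (i * (i - 1))"
  using assms by (simp add: theta_term_def flip: power_int_numeral power_int_mult)

lemma theta_term_square_odd:
  assumes "q \<noteq> 0"
  shows "theta_term (q^2) (- q * x^2) i = x powi (2 * i) * q powi (i * i)"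
proof -
  have "(q * x^2) powi i * q powi (i * (i - 1)) = x powi (2 * i) * q powi (i + i * (i - 1))"
    using assms by (simp add: power_int_mult_distrib power_int_add power_int_mult)
  then show ?thesis
    using assms by (simp add: theta_term_def algebra_simps flip: power_int_numeral power_int_mult)
qed

lemma theta_term_mult:
  assumes "q \<noteq> 0" "x \<noteq> 0" "y \<noteq> 0"
    and exponent: "m * (m - 1) + n * (n - 1) = 2 * e"
  shows "theta_term q (x * y) m * theta_term q (x / y) n =
    (- 1) powi (m + n) * x powi (m + n) * y powi (m - n) * q powi e"
proof -
  have "m * (m - 1) div 2 + n * (n - 1) div 2 = e"
  proof -
    have "2 * (m * (m - 1) div 2) = m * (m - 1)" "2 * (n * (n - 1) div 2) = n * (n - 1)"
      by simp_all
    with exponent show ?thesis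
      by linarith
  qed
  then have "q powi e = q powi (m * (m - 1) div 2) * q powi (n * (n - 1) div 2)"
    using assms by (simp flip: power_int_add)
  moreover have "(- (x * y)) powi m * (- (x / y)) powi n =
      (- 1) powi (m + n) * x powi (m + n) * y powi (m - n)"
    using assms by (simp add: power_int_minus_left power_int_mult_distrib power_int_divide_distrib
        power_int_add power_int_diff)
  ultimately show ?thesis
    by (simp add: theta_term_def mult_ac)
qed

lemma theta_term_mult_even:
  assumes "q \<noteq> 0" "x \<noteq> 0" "y \<noteq> 0"
  shows "theta_term q (x * y) (i + j) * theta_term q (x / y) (i - j) =
    theta_term (q^2) (- (x^2)) i * theta_term (q^2) (- q * y^2) j"
  unfolding theta_term_square[OF assms(1)] theta_term_square_odd[OF assms(1)]
  by (subst theta_term_mult[OF assms, where e = "i * (i - 1) + j * j"])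
    (use assms in \<open>simp_all add: algebra_simps power_int_add power_int_diff power_int_minus_left\<close>)

lemma theta_term_mult_odd:
  assumes "q \<noteq> 0" "x \<noteq> 0" "y \<noteq> 0"
  shows "theta_term q (x * y) (i + j) * theta_term q (x / y) (i - j + 1) =
    - (x / y) * (theta_term (q^2) (- q * x^2) i * theta_term (q^2) (- (y^2)) j)"
  unfolding theta_term_square[OF assms(1)] theta_term_square_odd[OF assms(1)]
  by (subst theta_term_mult[OF assms, where e = "i * i + j * (j - 1)"])
    (use assms in \<open>simp_all add: algebra_simps power_int_add power_int_diff power_int_minus_left\<close>)

theorem theta_sum_addition:
  fixes q x y :: "'a::{real_normed_field,banach}"
  assumes q: "norm q < 1" "q \<noteq> 0" and x: "x \<noteq> 0" and y: "y \<noteq> 0"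
  shows "theta_sum q (x * y) * theta_sum q (x / y) =
    theta_sum (q^2) (- (x^2)) * theta_sum (q^2) (- q * y^2) -
    x / y * (theta_sum (q^2) (- q * x^2) * theta_sum (q^2) (- (y^2)))"
proof -
  have product: "((\<lambda>(i, j). theta_term p u i * theta_term p v j) has_sum
      (theta_sum p u * theta_sum p v)) UNIV"
    if "norm p < 1" "p \<noteq> 0" "u \<noteq> 0" "v \<noteq> 0" for p u v :: 'a
    using has_sum_product[OF has_sum_theta_term abs_summable_theta_term has_sum_theta_term
        abs_summable_theta_term, of p u p v] that by simp
  have q2: "norm (q^2) < 1" "q^2 \<noteq> 0"
    using q by (auto simp: norm_power power_less_one_iff)
  have "((\<lambda>(m, n). theta_term q (x * y) m * theta_term q (x / y) n) has_sum
      (theta_sum (q^2) (- (x^2)) * theta_sum (q^2) (- q * y^2) +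
       - (x / y) * (theta_sum (q^2) (- q * x^2) * theta_sum (q^2) (- (y^2))))) UNIV"
  proof (rule has_sum_int_pairs_parity)
    show "((\<lambda>(i, j). theta_term q (x * y) (i + j) * theta_term q (x / y) (i - j)) has_sum
        theta_sum (q^2) (- (x^2)) * theta_sum (q^2) (- q * y^2)) UNIV"
      unfolding theta_term_mult_even[OF q(2) x y] using x y q by (intro product q2) auto
    show "((\<lambda>(i, j). theta_term q (x * y) (i + j) * theta_term q (x / y) (i - j + 1)) has_sum
        - (x / y) * (theta_sum (q^2) (- q * x^2) * theta_sum (q^2) (- (y^2)))) UNIV"
      unfolding theta_term_mult_odd[OF q(2) x y]
      using has_sum_cmult_right[OF product[OF q2, of "- q * x^2" "- (y^2)"], of "- (x / y)"] x y q
      by (simp add: case_prod_unfold)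
  qed
  moreover have "((\<lambda>(m, n). theta_term q (x * y) m * theta_term q (x / y) n) has_sum
      (theta_sum q (x * y) * theta_sum q (x / y))) UNIV"
    using x y by (intro product q) auto
  ultimately show ?thesis
    using has_sum_unique by fastforce
qed

lemma theta_prod_determinant:
  fixes q :: "'a::{real_normed_field,banach}"
  assumes q: "norm q < 1" "q \<noteq> 0"
  obtains P Q where "\<And>x y. x \<noteq> 0 \<Longrightarrow> y \<noteq> 0 \<Longrightarrow>
    theta_prod q (x * y) * theta_prod q (x / y) = x * (P x * Q y - P y * Q x)"
proof
  define c where "c = qpochhammer_inf q q"
  let ?P = "\<lambda>x. theta_sum (q^2) (- (x^2)) / x / c^2" and ?Q = "\<lambda>x. theta_sum (q^2) (- q * x^2)"
  fix x y :: 'a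
  assume "x \<noteq> 0" "y \<noteq> 0"
  have "c \<noteq> 0"
    using qpochhammer_inf_nonzero[OF q(1) q(1)] by (simp add: c_def)
  then have "theta_prod q (x * y) * theta_prod q (x / y) = theta_sum q (x * y) * theta_sum q (x / y) / c^2"
    by (simp add: theta_sum_def c_def power2_eq_square)
  also have "\<dots> = x * (?P x * ?Q y - ?P y * ?Q x)"
    using \<open>x \<noteq> 0\<close> \<open>y \<noteq> 0\<close> \<open>c \<noteq> 0\<close> unfolding theta_sum_addition[OF q \<open>x \<noteq> 0\<close> \<open>y \<noteq> 0\<close>]
    by (simp add: field_simps)
  finally show "theta_prod q (x * y) * theta_prod q (x / y) = x * (?P x * ?Q y - ?P y * ?Q x)" .
qed

theorem theta_prod_three_term:
  fixes q x y u v :: "'a::{real_normed_field,banach}"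
  assumes q: "norm q < 1" "q \<noteq> 0" and nz: "x \<noteq> 0" "y \<noteq> 0" "u \<noteq> 0" "v \<noteq> 0"
  defines "J \<equiv> theta_prod q"
  shows "J (x * y) * J (x / y) * (J (u * v) * J (u / v)) - J (x * v) * J (x / v) * (J (u * y) * J (u / y)) =
    u / y * (J (y * v) * J (y / v) * (J (x * u) * J (x / u)))"
proof -
  obtain P Q where det: "\<And>a b. a \<noteq> 0 \<Longrightarrow> b \<noteq> 0 \<Longrightarrow> J (a * b) * J (a / b) = a * (P a * Q b - P b * Q a)"
    unfolding J_def using theta_prod_determinant[OF q] by blast
  show ?thesis
    using nz by (simp add: det) (simp add: field_simps)
qed

subsection \<open>Transformations of the theta product\<close>

lemma theta_prod_reflect: "q \<noteq> 0 \<Longrightarrow> theta_prod q (q / x) = theta_prod q x"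
  by (simp add: theta_prod_def mult.commute)

lemma theta_prod_shift:
  assumes "norm q < 1" "q \<noteq> 0" "x \<noteq> 0"
  shows "theta_prod q (q * x) = - theta_prod q x / x"
proof -
  have "qpochhammer_inf (1 / x) q = (1 - 1 / x) * qpochhammer_inf (q / x) q"
    using qpochhammer_inf_unfold[OF assms(1), of "1 / x"] by simp
  moreover have "qpochhammer_inf x q = (1 - x) * qpochhammer_inf (q * x) q"
    using qpochhammer_inf_unfold[OF assms(1), of x] by (simp add: mult.commute)
  ultimately show ?thesis
    using assms(2,3) by (simp add: theta_prod_def) (simp add: field_simps)
qed

lemma qpochhammer_inf_mult_uminus:
  fixes a q :: "'a::{real_normed_field,banach}"
  assumes "norm q < 1"
  shows "qpochhammer_inf a q * qpochhammer_inf (- a) q = qpochhammer_inf (a^2) (q^2)"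
  unfolding qpochhammer_inf_def prodinf_mult[OF convergent_prod_one_minus_geometric[OF assms]
      convergent_prod_one_minus_geometric[OF assms]]
  by (simp add: algebra_simps power2_eq_square power_mult_distrib)

lemma theta_prod_mult_uminus:
  assumes "norm q < 1"
  shows "theta_prod q x * theta_prod q (- x) = theta_prod (q^2) (x^2)"
  using qpochhammer_inf_mult_uminus[OF assms, of x] qpochhammer_inf_mult_uminus[OF assms, of "q / x"]
  by (simp add: theta_prod_def power_divide mult_ac)

lemma qpochhammer_inf_bisect:
  fixes a q :: "'a::{real_normed_field,banach}"
  assumes "norm q < 1"
  shows "qpochhammer_inf a (q^2) * qpochhammer_inf (a * q) (q^2) = qpochhammer_inf a q"
proof -
  have "norm (q^2) < 1"
    using assms by (simp add: norm_power power_less_one_iff)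
  have "qpochhammer a (q^2) N * qpochhammer (a * q) (q^2) N = qpochhammer a q (2 * N)" for N
    by (induction N) (simp_all add: qpochhammer_Suc mult_ac flip: power_mult)
  moreover have "(\<lambda>N. qpochhammer a (q^2) N * qpochhammer (a * q) (q^2) N) \<longlonglongrightarrow>
      qpochhammer_inf a (q^2) * qpochhammer_inf (a * q) (q^2)"
    by (intro tendsto_mult qpochhammer_tendsto) fact+
  moreover have "(\<lambda>N. qpochhammer a q (2 * N)) \<longlonglongrightarrow> qpochhammer_inf a q"
    by (rule filterlim_compose[OF qpochhammer_tendsto[OF assms]])
      (auto intro!: filterlim_subseq simp: strict_mono_def)
  ultimately show ?thesis
    by (simp add: LIMSEQ_unique)
qed

lemma theta_prod_bisect:
  assumes "norm q < 1" "q \<noteq> 0"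
  shows "theta_prod (q^2) x * theta_prod (q^2) (q * x) = theta_prod q x"
  using qpochhammer_inf_bisect[OF assms(1), of x] qpochhammer_inf_bisect[OF assms(1), of "q / x"] assms(2)
  by (simp add: theta_prod_def power2_eq_square mult_ac)

lemma theta_prod_nonzero:
  assumes "norm q < norm x" "norm x < 1"
  shows "theta_prod q x \<noteq> 0"
  using assms unfolding theta_prod_def
  by (intro no_zero_divisors qpochhammer_inf_nonzero) (auto simp: norm_divide divide_less_eq)

subsection \<open>Normalised theta functions\<close>

text \<open>
  \<open>theta_exponent M a\<close> is \<open>M / 2\<close> times the Bernoulli polynomial \<open>B\<^sub>2 (a / M)\<close>; with this power of
  \<open>q\<close> all the transformations of the theta product lose their monomial factors.
\<close>

definition theta_exponent :: "real \<Rightarrow> real \<Rightarrow> real" where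
  "theta_exponent M a = a^2 / (2 * M) - a / 2 + M / 12"

definition norm_theta :: "real \<Rightarrow> real \<Rightarrow> real \<Rightarrow> real \<Rightarrow> real" where
  "norm_theta s q M a = q powr theta_exponent M a * theta_prod (q powr M) (s * q powr a)"

locale nome =
  fixes q M :: real
  assumes q: "0 < q" "q < 1" and M: "0 < M"
begin

lemma norm_base_less_one: "norm (q powr M) < 1"
  using q M by (simp add: powr01_less_one)

lemma base_nonzero: "q powr M \<noteq> 0"
  using q by simp

lemma powr_theta_exponent_four_prod:
  assumes "a + b + c + d = 2 * h"
  defines "E \<equiv> \<lambda>a. q powr theta_exponent M a"
  shows "E a * E b * (E c * E d) = q powr ((a^2 + b^2 + c^2 + d^2) / (2 * M) + M / 3) * q powr (- h)"
proof -
  have "h = (a + b + c + d) / 2"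
    using assms(1) by simp
  then show ?thesis
    unfolding E_def powr_add[symmetric] theta_exponent_def
    by (intro arg_cong[of _ _ "(powr) q"]) (simp add: add_divide_distrib)
qed

lemma norm_theta_four_prod:
  assumes "a + b + c + d = 2 * h"
  defines "J \<equiv> \<lambda>s a. theta_prod (q powr M) (s * q powr a)"
  shows "norm_theta s q M a * norm_theta s q M b * (norm_theta s q M c * norm_theta s q M d) =
    q powr ((a^2 + b^2 + c^2 + d^2) / (2 * M) + M / 3) * (q powr (- h) * (J s a * J s b * (J s c * J s d)))"
  unfolding mult.assoc[symmetric] norm_theta_def J_def
    powr_theta_exponent_four_prod[OF assms(1), unfolded mult.assoc[symmetric], symmetric]
  by (simp only: mult_ac)

theorem norm_theta_three_term:
  assumes s: "s * s = 1" and sum: "a + b + c + d = 2 * h"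
  defines "\<theta> \<equiv> norm_theta s q M" and "\<theta>\<^sub>1 \<equiv> norm_theta 1 q M"
  shows "\<theta> a * \<theta> b * (\<theta> c * \<theta> d) - \<theta>\<^sub>1 (h - a) * \<theta>\<^sub>1 (h - b) * (\<theta>\<^sub>1 (h - c) * \<theta>\<^sub>1 (h - d)) =
    \<theta> h * \<theta> (h - b - c) * (\<theta> (h - b - d) * \<theta> (h - c - d))"
proof -
  define x y u v where "x = (a + b) / 2" and "y = (a - b) / 2" and "u = (c + d) / 2" and "v = (c - d) / 2"
  then have half: "a = x + y" "b = x - y" "c = u + v" "d = u - v" "h = x + u"
    using sum by (simp_all add: field_simps)
  define J where "J s a = theta_prod (q powr M) (s * q powr a)" for s a
  have "s \<noteq> 0"
    using s by auto
  then have "1 / s = s"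
    using s by (simp add: divide_eq_eq)
  then have s_cancel: "t / (s * r) = s * (t / r)" "s * (s * t) = t" for t r :: real
    using s by (metis mult_1 times_divide_times_eq, metis mult.assoc mult_1)
  have "J s a * J s b * (J s c * J s d) - J 1 (h - a) * J 1 (h - b) * (J 1 (h - c) * J 1 (h - d)) =
      q powr (h - a) * (J s h * J s (h - b - c) * (J s (h - b - d) * J s (h - c - d)))"
    using theta_prod_three_term[OF norm_base_less_one base_nonzero,
        of "s * q powr x" "q powr y" "q powr u" "s * q powr v"]
      \<open>s \<noteq> 0\<close> s q
    by (simp add: half J_def s_cancel powr_add powr_diff mult_ac)
  then have "q powr (- h) * (J s a * J s b * (J s c * J s d)) -
      q powr (- h) * (J 1 (h - a) * J 1 (h - b) * (J 1 (h - c) * J 1 (h - d))) =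
      (q powr (- h) * q powr (h - a)) * (J s h * J s (h - b - c) * (J s (h - b - d) * J s (h - c - d)))"
    unfolding right_diff_distrib[symmetric] by (simp only: mult.assoc)
  moreover have "q powr (- h) * q powr (h - a) = q powr (- a)"
    unfolding powr_add[symmetric] by simp
  moreover have "(h - a)^2 + (h - b)^2 + (h - c)^2 + (h - d)^2 = a^2 + b^2 + c^2 + d^2"
    "h^2 + (h - b - c)^2 + (h - b - d)^2 + (h - c - d)^2 = a^2 + b^2 + c^2 + d^2"
    by (simp_all add: half power2_eq_square algebra_simps)
  moreover have "(h - a) + (h - b) + (h - c) + (h - d) = 2 * h"
    "h + (h - b - c) + (h - b - d) + (h - c - d) = 2 * a"
    using sum by simp_all
  ultimately show ?thesis
    unfolding \<theta>_def \<theta>\<^sub>1_def by (simp only: norm_theta_four_prod sum J_def right_diff_distrib[symmetric])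
qed

lemma norm_theta_shift:
  assumes "s \<noteq> 0"
  shows "norm_theta s q M (a + M) = - norm_theta s q M a / s"
proof -
  have "q powr theta_exponent M (a + M) = q powr theta_exponent M a * q powr a"
    unfolding powr_add[symmetric] using M
    by (intro arg_cong[of _ _ "(powr) q"]) (simp add: theta_exponent_def field_simps power2_eq_square)
  then show ?thesis
    using theta_prod_shift[OF norm_base_less_one base_nonzero, of "s * q powr a"] q assms
    by (simp add: norm_theta_def powr_add mult_ac)
qed

lemma norm_theta_one_shift_of_nat:
  "norm_theta 1 q M (a + of_nat n * M) = (- 1) ^ n * norm_theta 1 q M a"
proof (induction n)
  case (Suc n)
  then show ?case
    using norm_theta_shift[of 1 "a + of_nat n * M"] by (simp add: algebra_simps)
qed simp

lemma norm_theta_one_shift_of_int: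
  "norm_theta 1 q M (a + of_int m * M) = (- 1) powi m * norm_theta 1 q M a"
proof (cases m rule: int_cases2)
  case (nonneg n)
  then show ?thesis
    by (simp add: norm_theta_one_shift_of_nat)
next
  case (nonpos n)
  then show ?thesis
    using norm_theta_one_shift_of_nat[of "a - of_nat n * M" n]
    by (simp add: power_int_minus)
qed

lemma norm_theta_one_minus: "norm_theta 1 q M (- a) = - norm_theta 1 q M a"
proof -
  have "theta_exponent M (- a + M) = theta_exponent M a"
    using M by (simp add: theta_exponent_def field_simps power2_eq_square)
  moreover have "q powr M / q powr a = q powr (- a + M)"
    by (simp add: powr_diff[symmetric])
  ultimately have "norm_theta 1 q M (- a + M) = norm_theta 1 q M a"
    using theta_prod_reflect[OF base_nonzero, of "q powr a"] by (simp add: norm_theta_def)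
  then show ?thesis
    using norm_theta_shift[of 1 "- a"] by simp
qed

lemma norm_theta_bisect:
  "norm_theta s q (2 * M) a * norm_theta s q (2 * M) (a + M) = norm_theta s q M a"
proof -
  have "q powr theta_exponent M a = q powr theta_exponent (2 * M) a * q powr theta_exponent (2 * M) (a + M)"
    unfolding powr_add[symmetric] using M
    by (intro arg_cong[of _ _ "(powr) q"]) (simp add: theta_exponent_def field_simps power2_eq_square)
  moreover have "q powr (2 * M) = (q powr M)^2"
    by (simp add: power2_eq_square flip: powr_add)
  moreover have "s * q powr (a + M) = q powr M * (s * q powr a)"
    by (simp add: powr_add)
  ultimately show ?thesis
    unfolding norm_theta_def theta_prod_bisect[OF norm_base_less_one base_nonzero, symmetric]
    by (simp only: mult_ac)
qed

lemma norm_theta_mult_uminus: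
  "norm_theta 1 q M a * norm_theta (- 1) q M a = norm_theta 1 q (2 * M) (2 * a)"
proof -
  have "q powr theta_exponent M a * q powr theta_exponent M a = q powr theta_exponent (2 * M) (2 * a)"
    unfolding powr_add[symmetric] using M
    by (intro arg_cong[of _ _ "(powr) q"]) (simp add: theta_exponent_def field_simps power2_eq_square)
  moreover have "q powr (2 * t) = (q powr t)^2" for t
    by (simp add: power2_eq_square flip: powr_add)
  ultimately show ?thesis
    using theta_prod_mult_uminus[OF norm_base_less_one, of "q powr a"] by (simp add: norm_theta_def mult_ac)
qed

lemma norm_theta_one_nonzero:
  assumes "0 < a" "a < M"
  shows "norm_theta 1 q M a \<noteq> 0"
proof -
  have "norm (q powr M) < norm (q powr a)" "norm (q powr a) < 1"
    using q assms by (simp_all add: powr_less_mono' powr01_less_one)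
  then show ?thesis
    using theta_prod_nonzero[of "q powr M" "q powr a"] q by (simp add: norm_theta_def)
qed

end

definition residue_theta :: "real \<Rightarrow> int \<Rightarrow> int \<Rightarrow> real" where
  "residue_theta q M r = norm_theta 1 q (of_int M) (of_int r)"

locale residue_nome =
  fixes q :: real and M :: int
  assumes q: "0 < q" "q < 1" and M: "0 < M"
begin

sublocale nome q "of_int M"
  using q M by unfold_locales auto

lemma residue_theta_uminus: "residue_theta q M (- r) = - residue_theta q M r"
  using norm_theta_one_minus by (simp add: residue_theta_def)

lemma residue_theta_shift: "residue_theta q M (r + m * M) = (- 1) powi m * residue_theta q M r"
  using norm_theta_one_shift_of_int by (simp add: residue_theta_def)

lemma residue_theta_mod: "residue_theta q M r = (- 1) powi (r div M) * residue_theta q M (r mod M)"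
  using residue_theta_shift[of "r mod M" "r div M"] by simp

lemma residue_theta_reflect: "residue_theta q M (M - r) = residue_theta q M r"
  using residue_theta_shift[of "- r" 1] by (simp add: residue_theta_uminus)

lemma residue_theta_reduce:
  "M < 2 * r \<Longrightarrow> residue_theta q M r = (if even (r div M) then 1 else - 1) *
    residue_theta q M (if M < 2 * (r mod M) then M - r mod M else r mod M)"
  by (subst residue_theta_mod) (simp add: residue_theta_reflect power_int_minus_left)

lemma residue_theta_nonzero:
  assumes "\<not> M dvd r"
  shows "residue_theta q M r \<noteq> 0"
proof -
  have "r mod M \<noteq> 0"
    using assms by (simp add: dvd_eq_mod_eq_0)
  moreover have "0 \<le> r mod M" "r mod M < M"
    using M by simp_all
  ultimately have "residue_theta q M (r mod M) \<noteq> 0"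
    unfolding residue_theta_def by (intro norm_theta_one_nonzero) auto
  then show ?thesis
    by (subst residue_theta_mod) simp
qed

end

locale scaled_theta =
  fixes q :: real and N k :: int
  assumes q: "0 < q" "q < 1" and N: "0 < N" and coprime: "coprime k (2 * N)"
begin

definition \<theta> :: "int \<Rightarrow> real" where
  "\<theta> r = residue_theta q (2 * N) (k * r)"

definition theta_pair :: "int \<Rightarrow> real" where
  "theta_pair r = \<theta> r * \<theta> (N - r)"

definition theta_quot :: "int \<Rightarrow> real" where
  "theta_quot r = \<theta> (2 * r) / theta_pair r"

sublocale base: nome q "of_int N" + double: residue_nome q "2 * N"
  using q N by unfold_locales auto

lemma odd_k: "odd k"
  using coprime by (metis coprime_common_divisor dvd_triv_left even_numeral odd_one)

lemma theta_uminus: "\<theta> (- r) = - \<theta> r"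
  using double.residue_theta_uminus[of "k * r"] by (simp add: \<theta>_def)

lemma theta_reflect: "\<theta> (2 * N - r) = \<theta> r"
  using double.residue_theta_shift[of "- (k * r)" k] odd_k
    double.residue_theta_uminus[of "k * r"]
  by (simp add: \<theta>_def algebra_simps)

lemma theta_nonzero:
  assumes "\<not> 2 * N dvd r"
  shows "\<theta> r \<noteq> 0"
  unfolding \<theta>_def using assms coprime
  by (intro double.residue_theta_nonzero) (simp add: coprime_commute coprime_dvd_mult_right_iff)

lemma of_int_scaled_sum:
  assumes "a + b + c + d = 2 * h"
  shows "of_int (k * a) + of_int (k * b) + of_int (k * c) + of_int (k * d) = 2 * (of_int (k * h) :: real)"
  using arg_cong[OF assms, of "\<lambda>t. real_of_int (k * t)"] by (simp add: algebra_simps)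

lemma theta_three_term:
  assumes "a + b + c + d = 2 * h"
  shows "\<theta> a * \<theta> b * (\<theta> c * \<theta> d) - \<theta> (h - a) * \<theta> (h - b) * (\<theta> (h - c) * \<theta> (h - d)) =
    \<theta> h * \<theta> (h - b - c) * (\<theta> (h - b - d) * \<theta> (h - c - d))"
  using double.norm_theta_three_term[OF _ of_int_scaled_sum[OF assms], of 1]
  by (simp add: \<theta>_def residue_theta_def right_diff_distrib)

definition half_base_sign :: real where
  "half_base_sign = (- 1) powi (k div 2)"

lemma half_base_sign_square: "half_base_sign * half_base_sign = 1"
  by (simp add: half_base_sign_def power_int_minus_left)

lemma norm_theta_half_base: "norm_theta 1 q (of_int N) (of_int (k * r)) = half_base_sign * theta_pair r"
proof -
  have "k = 2 * (k div 2) + 1"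
    using odd_k by simp
  then have "k * r + N = k * (r + N) + - (k div 2) * (2 * N)"
    by algebra
  then have "residue_theta q (2 * N) (k * r + N) = half_base_sign * \<theta> (r + N)"
    using double.residue_theta_shift[of "k * (r + N)" "- (k div 2)"]
    by (simp only: \<theta>_def half_base_sign_def power_int_minus_one_minus)
  moreover have "\<theta> (r + N) = \<theta> (N - r)"
    using theta_reflect[of "N - r"] by (simp add: add.commute)
  ultimately show ?thesis
    using base.norm_theta_bisect[of 1 "of_int (k * r)"]
    by (simp add: theta_pair_def \<theta>_def residue_theta_def mult_ac)
qed

lemma norm_theta_uminus_half_base:
  assumes "\<not> N dvd r"
  shows "norm_theta (- 1) q (of_int N) (of_int (k * r)) = half_base_sign * theta_quot r"
proof -
  have "\<not> 2 * N dvd r" "\<not> 2 * N dvd N - r"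
    using assms by (meson dvd_mult_right, metis dvd_diff_right_iff dvd_mult_right dvd_refl)
  then have "theta_pair r \<noteq> 0"
    by (simp add: theta_pair_def theta_nonzero)
  have "half_base_sign * theta_pair r * norm_theta (- 1) q (of_int N) (of_int (k * r)) = \<theta> (2 * r)"
    using base.norm_theta_mult_uminus[of "of_int (k * r)"]
    unfolding norm_theta_half_base by (simp add: \<theta>_def residue_theta_def mult_ac)
  then have "half_base_sign * half_base_sign * theta_pair r * norm_theta (- 1) q (of_int N) (of_int (k * r)) =
      half_base_sign * \<theta> (2 * r)"
    by simp
  then show ?thesis
    using \<open>theta_pair r \<noteq> 0\<close> by (simp add: half_base_sign_square theta_quot_def field_simps)
qed

lemma theta_quot_uminus: "theta_quot (- r) = theta_quot r"
proof -
  have "theta_pair (- r) = - theta_pair r"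
    using theta_reflect[of "N - r"] by (simp add: theta_pair_def theta_uminus add.commute)
  then show ?thesis
    using theta_uminus[of "2 * r"] by (simp add: theta_quot_def)
qed

lemma theta_quot_reflect: "theta_quot (N - r) = theta_quot r"
  using theta_reflect[of "2 * r"] by (simp add: theta_quot_def theta_pair_def algebra_simps)

theorem theta_quot_three_term:
  assumes sum: "a + b + c + d = 2 * h"
    and nondvd: "\<forall>r\<in>{a, b, c, d, h, h - b - c, h - b - d, h - c - d}. \<not> N dvd r"
  shows "theta_quot a * theta_quot b * (theta_quot c * theta_quot d) -
      theta_pair (h - a) * theta_pair (h - b) * (theta_pair (h - c) * theta_pair (h - d)) =
    theta_quot h * theta_quot (h - b - c) * (theta_quot (h - b - d) * theta_quot (h - c - d))"
proof -
  let ?\<epsilon> = half_base_sign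
  have sign_cancel: "(?\<epsilon> * t) * (?\<epsilon> * u) * ((?\<epsilon> * v) * (?\<epsilon> * w)) = t * u * (v * w)" for t u v w
  proof -
    have "(?\<epsilon> * t) * (?\<epsilon> * u) * ((?\<epsilon> * v) * (?\<epsilon> * w)) = (?\<epsilon> * ?\<epsilon>) * (?\<epsilon> * ?\<epsilon>) * (t * u * (v * w))"
      by (simp only: mult_ac)
    then show ?thesis
      by (simp add: half_base_sign_square)
  qed
  have "norm_theta (- 1) q (of_int N) (of_int (k * r)) = ?\<epsilon> * theta_quot r"
    if "r \<in> {a, b, c, d, h, h - b - c, h - b - d, h - c - d}" for r
    using nondvd that by (intro norm_theta_uminus_half_base) blast
  then show ?thesis
    using base.norm_theta_three_term[OF _ of_int_scaled_sum[OF sum], of "- 1"]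
    unfolding of_int_diff[symmetric] right_diff_distrib[symmetric]
    by (simp add: norm_theta_half_base sign_cancel del: of_int_diff of_int_mult)
qed

end

subsection \<open>The theta function identity modulo 42\<close>

locale theta_mod_42 = scaled_theta q 21 k for q :: real and k :: int
begin

lemma theta_small_nonzero: "0 < r \<Longrightarrow> r < 42 \<Longrightarrow> \<theta> r \<noteq> 0"
  by (rule theta_nonzero) (simp add: zdvd_not_zless)

lemma theta_difference_half_base:
  "\<theta> 1 * \<theta> 16 * \<theta> 20 - \<theta> 2 * \<theta> 8 * \<theta> 13 =
    \<theta> 1 * \<theta> 2 * \<theta> 3 * \<theta> 5 * \<theta> 7 * \<theta> 8 * \<theta> 9 * \<theta> 11 * \<theta> 12 * \<theta> 13 * \<theta> 14 * \<theta> 16 * \<theta> 17 * \<theta> 19 * \<theta> 20"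
proof -
  note nonzero = theta_small_nonzero
  have "theta_quot 12 = theta_quot 9" "theta_quot (- 5) = theta_quot 5"
    using theta_quot_reflect[of 9] theta_quot_uminus[of 5] by simp_all
  with theta_quot_three_term[of 5 2 9 8 12]
  have "theta_quot 2 * theta_quot 5 * theta_quot 9 * (theta_quot 8 - theta_quot 1) =
      theta_pair 3 * theta_pair 4 * theta_pair 7 * theta_pair 10"
    by (simp add: algebra_simps)
  moreover have "theta_quot 2 * theta_quot 5 * theta_quot 9 =
      \<theta> 4 * \<theta> 10 * \<theta> 18 / (\<theta> 2 * \<theta> 5 * \<theta> 9 * \<theta> 12 * \<theta> 16 * \<theta> 19)"
    by (simp add: theta_quot_def theta_pair_def mult_ac)
  moreover have "theta_quot 8 - theta_quot 1 =
      (\<theta> 1 * \<theta> 16 * \<theta> 20 - \<theta> 2 * \<theta> 8 * \<theta> 13) / (\<theta> 1 * \<theta> 8 * \<theta> 13 * \<theta> 20)"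
    by (simp add: theta_quot_def theta_pair_def nonzero field_simps)
  moreover have "theta_pair 3 * theta_pair 4 * theta_pair 7 * theta_pair 10 =
      \<theta> 4 * \<theta> 10 * \<theta> 18 * (\<theta> 3 * \<theta> 7 * \<theta> 11 * \<theta> 14 * \<theta> 17)"
    by (simp add: theta_pair_def mult_ac)
  ultimately have "\<theta> 4 * \<theta> 10 * \<theta> 18 * ((\<theta> 1 * \<theta> 16 * \<theta> 20 - \<theta> 2 * \<theta> 8 * \<theta> 13) /
        (\<theta> 2 * \<theta> 5 * \<theta> 9 * \<theta> 12 * \<theta> 16 * \<theta> 19 * (\<theta> 1 * \<theta> 8 * \<theta> 13 * \<theta> 20))) =
      \<theta> 4 * \<theta> 10 * \<theta> 18 * (\<theta> 3 * \<theta> 7 * \<theta> 11 * \<theta> 14 * \<theta> 17)"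
    by (simp only: times_divide_eq_left times_divide_eq_right divide_divide_eq_left)
  then have "(\<theta> 1 * \<theta> 16 * \<theta> 20 - \<theta> 2 * \<theta> 8 * \<theta> 13) /
      (\<theta> 2 * \<theta> 5 * \<theta> 9 * \<theta> 12 * \<theta> 16 * \<theta> 19 * (\<theta> 1 * \<theta> 8 * \<theta> 13 * \<theta> 20)) = \<theta> 3 * \<theta> 7 * \<theta> 11 * \<theta> 14 * \<theta> 17"
    by (rule mult_left_cancel[THEN iffD1, rotated]) (simp add: nonzero)
  then have "\<theta> 1 * \<theta> 16 * \<theta> 20 - \<theta> 2 * \<theta> 8 * \<theta> 13 =
      \<theta> 3 * \<theta> 7 * \<theta> 11 * \<theta> 14 * \<theta> 17 * (\<theta> 2 * \<theta> 5 * \<theta> 9 * \<theta> 12 * \<theta> 16 * \<theta> 19 * (\<theta> 1 * \<theta> 8 * \<theta> 13 * \<theta> 20))"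
    by (subst (asm) nonzero_divide_eq_eq) (simp_all add: nonzero)
  then show ?thesis
    by (simp only: mult_ac)
qed

lemma theta_difference_double_base:
  "(\<theta> 2 * \<theta> 8 * \<theta> 13 * \<theta> 15 - \<theta> 4 * \<theta> 5 * \<theta> 9 * \<theta> 16) * (\<theta> 12 * \<theta> 14) =
    \<theta> 4 * \<theta> 15 * \<theta> 18 * (\<theta> 1 * \<theta> 16 * \<theta> 20 - \<theta> 2 * \<theta> 8 * \<theta> 13)"
proof -
  have three_term_2_8: "\<theta> 2 * \<theta> 8 * (\<theta> 12 * \<theta> 14) = \<theta> 4 * \<theta> 6 * (\<theta> 10 * \<theta> 16) - \<theta> 2 * \<theta> 4 * (\<theta> 8 * \<theta> 18)"
    using theta_three_term[of 8 2 14 12 18] theta_uminus[of 8] by (simp add: mult_ac)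
  have three_term_5_9: "\<theta> 5 * \<theta> 9 * (\<theta> 12 * \<theta> 14) = \<theta> 6 * \<theta> 10 * (\<theta> 13 * \<theta> 15) - \<theta> 1 * \<theta> 15 * (\<theta> 18 * \<theta> 20)"
    using theta_three_term[of 32 6 15 13 33] theta_reflect[of 10] theta_reflect[of 15] theta_reflect[of 9]
    by (simp add: mult_ac)
  have "(\<theta> 2 * \<theta> 8 * \<theta> 13 * \<theta> 15 - \<theta> 4 * \<theta> 5 * \<theta> 9 * \<theta> 16) * (\<theta> 12 * \<theta> 14) =
      \<theta> 13 * \<theta> 15 * (\<theta> 2 * \<theta> 8 * (\<theta> 12 * \<theta> 14)) - \<theta> 4 * \<theta> 16 * (\<theta> 5 * \<theta> 9 * (\<theta> 12 * \<theta> 14))"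
    by (simp add: algebra_simps)
  also have "\<dots> = \<theta> 4 * \<theta> 15 * \<theta> 18 * (\<theta> 1 * \<theta> 16 * \<theta> 20 - \<theta> 2 * \<theta> 8 * \<theta> 13)"
    unfolding three_term_2_8 three_term_5_9 by (simp add: algebra_simps)
  finally show ?thesis .
qed

theorem reciprocal_identity:
  "1 / (\<Prod>r\<in>{1, 3, 4, 5, 7, 9, 11, 16, 17, 18, 19, 20}. \<theta> r) -
   1 / (\<Prod>r\<in>{1, 2, 3, 7, 8, 11, 13, 15, 17, 18, 19, 20}. \<theta> r) = 1"
proof -
  define p a b where "p = \<theta> 1 * \<theta> 3 * \<theta> 7 * \<theta> 11 * \<theta> 17 * \<theta> 18 * \<theta> 19 * \<theta> 20"
    and "a = \<theta> 2 * \<theta> 8 * \<theta> 13 * \<theta> 15" and "b = \<theta> 4 * \<theta> 5 * \<theta> 9 * \<theta> 16"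
  have nonzero: "p \<noteq> 0" "a \<noteq> 0" "b \<noteq> 0" "\<theta> 12 * \<theta> 14 \<noteq> 0"
    by (simp_all add: p_def a_def b_def theta_small_nonzero)
  have "(a - b) * (\<theta> 12 * \<theta> 14) = p * a * b * (\<theta> 12 * \<theta> 14)"
    unfolding a_def b_def p_def theta_difference_double_base theta_difference_half_base
    by (simp only: mult_ac)
  then have "a - b = p * a * b"
    using nonzero by simp
  moreover have "1 / (p * b) - 1 / (p * a) = (a - b) / (p * a * b)"
    using nonzero by (simp add: diff_divide_distrib)
  moreover have "(\<Prod>r\<in>{1, 3, 4, 5, 7, 9, 11, 16, 17, 18, 19, 20}. \<theta> r) = p * b"
    "(\<Prod>r\<in>{1, 2, 3, 7, 8, 11, 13, 15, 17, 18, 19, 20}. \<theta> r) = p * a"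
    by (simp_all add: p_def a_def b_def)
  ultimately show ?thesis
    using nonzero by simp
qed

end

subsection \<open>Generating functions of partitions\<close>

lemma partitions_into_empty: "partitions_into {} n = (if n = 0 then {{#}} else {})"
  by (auto simp: partitions_into_def)

lemma partitions_into_insert:
  assumes "s > 0"
  shows "partitions_into (insert s F) n =
    partitions_into F n \<union> (if s \<le> n then add_mset s ` partitions_into (insert s F) (n - s) else {})"
    (is "?L = ?R")
proof (intro equalityI subsetI)
  fix P assume P: "P \<in> ?L"
  show "P \<in> ?R"
  proof (cases "s \<in># P")
    case True
    then obtain Q where Q: "P = add_mset s Q"
      by (meson mset_add)
    with P have "s \<le> n" "Q \<in> partitions_into (insert s F) (n - s)"
      by (auto simp: partitions_into_def)
    with Q show ?thesis
      by auto
  next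
    case False
    with P show ?thesis
      by (auto simp: partitions_into_def)
  qed
qed (auto simp: partitions_into_def split: if_splits)

lemma partitions_into_Int_lessThan:
  assumes "n < N"
  shows "partitions_into (S \<inter> {..<N}) n = partitions_into S n"
proof -
  have "x < N" if "x \<in># P" "sum_mset P = n" for P x
    using that assms by (metis le_add1 le_less_trans mset_add sum_mset.add_mset)
  then show ?thesis
    by (auto simp: partitions_into_def)
qed

lemma finite_partitions_into:
  assumes "0 \<notin> S"
  shows "finite (partitions_into S n)"
proof -
  have "finite (partitions_into F m)" if "finite F" "0 \<notin> F" for F m
    using that
  proof (induction F arbitrary: m rule: finite_induct)
    case empty
    then show ?case
      by (simp add: partitions_into_empty)
  next
    case (insert s F)
    show ?case
    proof (induction m rule: less_induct)
      case (less m)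
      with insert show ?case
        by (subst partitions_into_insert) auto
    qed
  qed
  from this[of "S \<inter> {..<Suc n}" n] assms show ?thesis
    by (simp add: partitions_into_Int_lessThan)
qed

lemma partition_count_empty: "partition_count {} n = (if n = 0 then 1 else 0)"
  by (simp add: partition_count_def partitions_into_empty)

lemma partition_count_Int_lessThan: "n < N \<Longrightarrow> partition_count (S \<inter> {..<N}) n = partition_count S n"
  by (simp add: partition_count_def partitions_into_Int_lessThan)

lemma partition_count_mono:
  assumes "S \<subseteq> S'" "0 \<notin> S'"
  shows "partition_count S n \<le> partition_count S' n"
  unfolding partition_count_def
  by (rule card_mono[OF finite_partitions_into[OF assms(2)]]) (use assms in \<open>auto simp: partitions_into_def\<close>)

lemma partition_count_insert:
  assumes "0 \<notin> F" "s > 0" "s \<notin> F"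
  shows "partition_count (insert s F) n =
    partition_count F n + (if s \<le> n then partition_count (insert s F) (n - s) else 0)"
proof -
  let ?A = "if s \<le> n then add_mset s ` partitions_into (insert s F) (n - s) else {}"
  have "finite (partitions_into F n)" "finite ?A" "partitions_into F n \<inter> ?A = {}"
    using assms by (auto simp: finite_partitions_into) (auto simp: partitions_into_def)
  then have "partition_count (insert s F) n = card (partitions_into F n) + card ?A"
    unfolding partition_count_def partitions_into_insert[OF \<open>s > 0\<close>, of F n] by (rule card_Un_disjoint)
  also have "card ?A = (if s \<le> n then partition_count (insert s F) (n - s) else 0)"
    by (auto simp: partition_count_def intro!: card_image inj_onI)
  finally show ?thesis
    by (simp add: partition_count_def)
qed

lemma sums_delayed:
  fixes f :: "nat \<Rightarrow> 'a::real_normed_vector"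
  shows "(\<lambda>n. if s \<le> n then f (n - s) else 0) sums a \<longleftrightarrow> f sums a"
  using sums_zero_iff_shift[of s "\<lambda>n. if s \<le> n then f (n - s) else 0" a] by simp

lemma sum_delayed_le:
  fixes f :: "nat \<Rightarrow> real"
  assumes "\<And>n. 0 \<le> f n"
  shows "(\<Sum>n<m. if s \<le> n then f (n - s) else 0) \<le> (\<Sum>n<m. f n)"
proof -
  have "(\<Sum>n<m. if s \<le> n then f (n - s) else 0) = (\<Sum>n\<in>{n. n < m \<and> s \<le> n}. f (n - s))"
    by (auto simp: sum.If_cases Int_def)
  also have "\<dots> = (\<Sum>n\<in>{n. n + s < m}. f n)"
    by (rule sum.reindex_bij_witness[of _ "\<lambda>n. n + s" "\<lambda>n. n - s"]) auto
  also have "\<dots> \<le> (\<Sum>n<m. f n)"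
    using assms by (intro sum_mono2) auto
  finally show ?thesis .
qed

lemma delayed_recurrence_summable:
  fixes a c :: "nat \<Rightarrow> 'a::real_normed_field"
  assumes rec: "\<And>n. a n = c n + (if s \<le> n then x * a (n - s) else 0)"
    and x: "norm x < 1" and c: "summable (\<lambda>n. norm (c n))"
  shows "summable (\<lambda>n. norm (a n))"
proof -
  have "(\<Sum>n<m. norm (a n)) \<le> (\<Sum>n. norm (c n)) / (1 - norm x)" for m
  proof -
    have "norm (a n) \<le> norm (c n) + norm x * (if s \<le> n then norm (a (n - s)) else 0)" for n
      by (subst rec) (auto simp: norm_mult intro: norm_triangle_le)
    then have "(\<Sum>n<m. norm (a n)) \<le>
        (\<Sum>n<m. norm (c n)) + norm x * (\<Sum>n<m. if s \<le> n then norm (a (n - s)) else 0)"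
      unfolding sum_distrib_left sum.distrib[symmetric] by (rule sum_mono)
    also have "\<dots> \<le> (\<Sum>n. norm (c n)) + norm x * (\<Sum>n<m. norm (a n))"
      by (intro add_mono mult_left_mono sum_le_suminf c sum_delayed_le) auto
    finally show ?thesis
      using x by (simp add: field_simps)
  qed
  then show ?thesis
    by (intro summableI_nonneg_bounded) auto
qed

lemma delayed_recurrence_sums:
  fixes a c :: "nat \<Rightarrow> 'a::{real_normed_field,banach}"
  assumes rec: "\<And>n. a n = c n + (if s \<le> n then x * a (n - s) else 0)"
    and x: "norm x < 1" and c: "summable (\<lambda>n. norm (c n))" "c sums C"
  shows "a sums (C / (1 - x))"
proof -
  obtain A where A: "a sums A"
    using delayed_recurrence_summable[OF rec x c(1)] summable_norm_cancel summable_sums by blast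
  have "(\<lambda>n. if s \<le> n then x * a (n - s) else 0) sums (x * A)"
    using sums_delayed[of s "\<lambda>n. x * a n"] sums_mult[OF A] by simp
  from sums_add[OF c(2) this] have "a sums (C + x * A)"
    unfolding rec[symmetric] .
  with A have "A = C + x * A"
    by (rule sums_unique2)
  moreover have "1 - x \<noteq> 0"
    using x by auto
  ultimately have "A = C / (1 - x)"
    by (simp add: field_simps)
  with A show ?thesis
    by simp
qed

lemma partition_generating_function_finite:
  fixes q :: "'a::{real_normed_field,banach}"
  assumes q: "norm q < 1" and "finite F" "0 \<notin> F"
  shows "summable (\<lambda>n. norm (of_nat (partition_count F n) * q ^ n)) \<and>
    (\<lambda>n. of_nat (partition_count F n) * q ^ n) sums (1 / (\<Prod>s\<in>F. 1 - q ^ s))"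
  using \<open>finite F\<close> \<open>0 \<notin> F\<close>
proof (induction F rule: finite_induct)
  case empty
  have "(\<lambda>n. of_nat (partition_count {} n) * q ^ n) = (\<lambda>n. if n = 0 then q ^ n else 0)"
    by (auto simp: partition_count_empty)
  then show ?case
    using sums_single[of 0 "\<lambda>n. q ^ n"]
    by (auto simp: partition_count_empty split: if_splits intro!: summable_finite[of "{0}"])
next
  case (insert s F)
  then have s: "0 \<notin> F" "s > 0" "s \<notin> F" by auto
  have "norm (q ^ s) < 1"
    using q s by (simp add: norm_power power_less_one_iff)
  have rec: "of_nat (partition_count (insert s F) n) * q ^ n = of_nat (partition_count F n) * q ^ n +
      (if s \<le> n then q ^ s * (of_nat (partition_count (insert s F) (n - s)) * q ^ (n - s)) else 0)" for n
  proof -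
    have "q ^ n = q ^ s * q ^ (n - s)" if "s \<le> n"
      using that by (simp flip: power_add)
    then show ?thesis
      using partition_count_insert[OF s, of n] by (simp add: distrib_right)
  qed
  have IH: "summable (\<lambda>n. norm (of_nat (partition_count F n) * q ^ n))"
    "(\<lambda>n. of_nat (partition_count F n) * q ^ n) sums (1 / (\<Prod>s\<in>F. 1 - q ^ s))"
    using insert s by auto
  show ?case
    using delayed_recurrence_summable[OF rec \<open>norm (q ^ s) < 1\<close> IH(1)]
      delayed_recurrence_sums[OF rec \<open>norm (q ^ s) < 1\<close> IH] insert.hyps
    by (simp add: mult.commute[of "1 - q ^ s"])
qed

lemma convergent_prod_one_minus_power:
  fixes q :: "'a::{real_normed_field,banach}"
  assumes "norm q < 1"
  shows "convergent_prod (\<lambda>n. if n \<in> S then 1 - q ^ n else 1)"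
proof -
  have "summable (\<lambda>n. norm ((if n \<in> S then 1 - q ^ n else 1) - 1))"
    by (rule summable_comparison_test[OF _ summable_geometric[of "norm q"]])
      (use assms in \<open>auto simp: norm_power\<close>)
  then show ?thesis
    by (intro abs_convergent_prod_imp_convergent_prod summable_imp_abs_convergent_prod)
qed

definition euler_prod :: "nat set \<Rightarrow> 'a::{real_normed_field,banach} \<Rightarrow> 'a" where
  "euler_prod S q = (\<Prod>n. if n \<in> S then 1 - q ^ n else 1)"

lemma euler_prod_tendsto:
  fixes q :: "'a::{real_normed_field,banach}"
  assumes "norm q < 1"
  shows "(\<lambda>N. \<Prod>n\<in>S \<inter> {..<N}. 1 - q ^ n) \<longlonglongrightarrow> euler_prod S q"
proof -
  have "(\<Prod>n<N. if n \<in> S then 1 - q ^ n else 1) = (\<Prod>n\<in>S \<inter> {..<N}. 1 - q ^ n)" for N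
    by (simp add: prod.If_cases Int_commute)
  then show ?thesis
    using has_prod_imp_tendsto'[OF convergent_prod_has_prod[OF
          convergent_prod_one_minus_power[OF assms]], of S]
    by (simp add: euler_prod_def)
qed

lemma euler_prod_nonzero:
  fixes q :: "'a::{real_normed_field,banach}"
  assumes "norm q < 1" "0 \<notin> S"
  shows "euler_prod S q \<noteq> 0"
  unfolding euler_prod_def
proof (rule prodinf_nonzero[OF convergent_prod_one_minus_power[OF assms(1)]])
  fix n
  have "1 - q ^ n \<noteq> 0" if "n \<in> S"
  proof -
    have "norm (q ^ n) < 1"
      using assms that by (cases "n = 0") (auto simp: norm_power power_less_one_iff)
    then show ?thesis by auto
  qed
  then show "(if n \<in> S then 1 - q ^ n else 1) \<noteq> 0"
    by simp
qed

lemma summable_partition_count: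
  fixes r :: real
  assumes r: "0 \<le> r" "r < 1" and S: "0 \<notin> S"
  shows "summable (\<lambda>n. partition_count S n * r ^ n)"
proof -
  let ?X = "\<lambda>N. 1 / (\<Prod>n\<in>S \<inter> {..<N}. 1 - r ^ n)"
  have gf: "(\<lambda>n. partition_count (S \<inter> {..<N}) n * r ^ n) sums ?X N" for N
    using partition_generating_function_finite[of r "S \<inter> {..<N}"] r S by simp
  have "?X \<longlonglongrightarrow> 1 / euler_prod S r"
    using r by (intro tendsto_intros euler_prod_tendsto euler_prod_nonzero S) auto
  then obtain K where K: "norm (?X N) \<le> K" for N
    by (metis BseqE convergentI convergent_imp_Bseq)
  have "(\<Sum>n<N. partition_count S n * r ^ n) \<le> K" for N
  proof -
    have "(\<Sum>n<N. partition_count S n * r ^ n) = (\<Sum>n<N. partition_count (S \<inter> {..<N}) n * r ^ n)"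
      by (simp add: partition_count_Int_lessThan)
    also have "\<dots> \<le> ?X N"
      using sum_le_suminf[OF sums_summable[OF gf]] gf r by (simp add: sums_iff)
    also have "\<dots> \<le> K"
      using K[of N] by (simp only: real_norm_def abs_le_D1)
    finally show ?thesis .
  qed
  then show ?thesis
    using r by (intro summableI_nonneg_bounded) auto
qed

theorem partition_generating_function:
  fixes q :: "'a::{real_normed_field,banach}"
  assumes q: "norm q < 1" and S: "0 \<notin> S"
  shows "(\<lambda>n. of_nat (partition_count S n) * q ^ n) sums (1 / euler_prod S q)"
proof -
  let ?a = "\<lambda>n N. of_nat (partition_count (S \<inter> {..<N}) n) * q ^ n"
  let ?b = "\<lambda>n. of_nat (partition_count S n) * q ^ n"
  have "(\<lambda>N. ?a n N) \<longlonglongrightarrow> ?b n" for n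
    by (rule tendsto_eventually, rule eventually_mono[OF eventually_gt_at_top[of n]])
      (simp add: partition_count_Int_lessThan)
  moreover have "norm (?a n N) \<le> partition_count S n * norm q ^ n" for n N
    using partition_count_mono[of "S \<inter> {..<N}" S n] S
    by (auto simp: norm_mult norm_power intro!: mult_right_mono)
  ultimately have "summable (\<lambda>n. norm (?b n))" "(\<lambda>N. \<Sum>n. ?a n N) \<longlonglongrightarrow> (\<Sum>n. ?b n)"
    using tannerys_theorem[of ?a ?b sequentially "\<lambda>n. partition_count S n * norm q ^ n"]
      summable_partition_count[of "norm q" S] q S by (simp_all add: case_prod_unfold)
  moreover have "(\<Sum>n. ?a n N) = 1 / (\<Prod>n\<in>S \<inter> {..<N}. 1 - q ^ n)" for N
    using partition_generating_function_finite[OF q, of "S \<inter> {..<N}"] S by (simp add: sums_iff)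
  moreover have "(\<lambda>N. 1 / (\<Prod>n\<in>S \<inter> {..<N}. 1 - q ^ n)) \<longlonglongrightarrow> 1 / euler_prod S q"
    by (intro tendsto_intros euler_prod_tendsto euler_prod_nonzero q S)
  ultimately have "(\<Sum>n. ?b n) = 1 / euler_prod S q"
    by (simp add: LIMSEQ_unique)
  with \<open>summable (\<lambda>n. norm (?b n))\<close> show ?thesis
    by (simp add: sums_iff summable_norm_cancel)
qed

lemma euler_prod_empty [simp]: "euler_prod {} q = 1"
  by (simp add: euler_prod_def)

lemma euler_prod_Un_disjoint:
  fixes q :: "'a::{real_normed_field,banach}"
  assumes "norm q < 1" "S \<inter> T = {}"
  shows "euler_prod (S \<union> T) q = euler_prod S q * euler_prod T q"
  unfolding euler_prod_def prodinf_mult[OF convergent_prod_one_minus_power[OF assms(1)]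
      convergent_prod_one_minus_power[OF assms(1)]]
  by (rule prodinf_cong) (use assms(2) in auto)

lemma euler_prod_UN_disjoint:
  fixes q :: "'a::{real_normed_field,banach}"
  assumes "norm q < 1" "finite I" "disjoint_family_on A I"
  shows "euler_prod (\<Union>i\<in>I. A i) q = (\<Prod>i\<in>I. euler_prod (A i) q)"
  using assms(2,3)
proof (induction I rule: finite_induct)
  case (insert i I)
  then have "A i \<inter> (\<Union>j\<in>I. A j) = {}"
    by (auto simp: disjoint_family_on_def)
  with insert show ?case
    by (simp add: euler_prod_Un_disjoint[OF assms(1)] disjoint_family_on_def)
qed simp

lemma residue_class_Int_lessThan:
  fixes m r N :: nat
  assumes "r < m"
  shows "{n. n mod m = r} \<inter> {..<m * N} = (\<lambda>k. m * k + r) ` {..<N}"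
proof (intro equalityI subsetI)
  fix n assume "n \<in> {n. n mod m = r} \<inter> {..<m * N}"
  then have "n = m * (n div m) + r" "n div m < N"
    by (auto simp: less_mult_imp_div_less mult.commute)
  then show "n \<in> (\<lambda>k. m * k + r) ` {..<N}"
    by blast
next
  fix n assume "n \<in> (\<lambda>k. m * k + r) ` {..<N}"
  then obtain k where n: "n = m * k + r" and k: "k < N"
    by auto
  have "m * k + r < m * Suc k"
    using assms by simp
  also have "\<dots> \<le> m * N"
    using k by (intro mult_le_mono) auto
  finally show "n \<in> {n. n mod m = r} \<inter> {..<m * N}"
    using assms n by simp
qed

lemma euler_prod_residue_class:
  fixes q :: "'a::{real_normed_field,banach}"
  assumes q: "norm q < 1" and r: "r < m"
  shows "euler_prod {n. n mod m = r} q = qpochhammer_inf (q ^ r) (q ^ m)"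
proof (rule LIMSEQ_unique)
  have "inj_on (\<lambda>k. m * k + r) A" for A
    using r by (auto simp: inj_on_def)
  then have "(\<Prod>n\<in>{n. n mod m = r} \<inter> {..<m * N}. 1 - q ^ n) = qpochhammer (q ^ r) (q ^ m) N" for N
    unfolding residue_class_Int_lessThan[OF r]
    by (simp add: prod.reindex qpochhammer_def power_add power_mult mult.commute[of "q ^ r"])
  moreover have "norm (q ^ m) < 1"
    using q r by (simp add: norm_power power_less_one_iff)
  ultimately show "(\<lambda>N. \<Prod>n\<in>{n. n mod m = r} \<inter> {..<m * N}. 1 - q ^ n) \<longlonglongrightarrow> qpochhammer_inf (q ^ r) (q ^ m)"
    using qpochhammer_tendsto by simp
  have "filterlim (\<lambda>N. m * N) at_top sequentially"
    using r by (intro filterlim_subseq) (auto simp: strict_mono_def)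
  then show "(\<lambda>N. \<Prod>n\<in>{n. n mod m = r} \<inter> {..<m * N}. 1 - q ^ n) \<longlonglongrightarrow> euler_prod {n. n mod m = r} q"
    by (rule filterlim_compose[OF euler_prod_tendsto[OF q]])
qed

lemma zero_notin_pm_residues: "0 \<notin> pm_residues R M"
  by (simp add: pm_residues_def)

lemma pm_residues_eq_UN:
  assumes R: "R \<subseteq> {r. 0 < r \<and> 2 * r < M}"
  shows "pm_residues R M = (\<Union>r\<in>R. {n. n mod nat M = nat r} \<union> {n. n mod nat M = nat (M - r)})"
proof -
  have cong_iff: "[int n = r] (mod M) \<longleftrightarrow> n mod nat M = nat r" if "0 \<le> r" "r < M" for r n
  proof -
    have "[int n = r] (mod M) \<longleftrightarrow> int n mod M = r"
      using that by (simp add: cong_def)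
    also have "int n mod M = int (n mod nat M)"
      using that by (simp add: zmod_int)
    finally show ?thesis
      using that by auto
  qed
  have neg_cong_iff: "[int n = - r] (mod M) \<longleftrightarrow> [int n = M - r] (mod M)" for n r
    by (simp add: cong_def)
  have "(\<exists>r\<in>R. [int n = r] (mod M) \<or> [int n = - r] (mod M)) \<longleftrightarrow>
      (\<exists>r\<in>R. n mod nat M = nat r \<or> n mod nat M = nat (M - r))" for n
  proof (rule bex_cong[OF refl])
    fix r assume "r \<in> R"
    then have "0 \<le> r" "r < M" "0 \<le> M - r" "M - r < M"
      using R by auto
    then show "[int n = r] (mod M) \<or> [int n = - r] (mod M) \<longleftrightarrow>
        n mod nat M = nat r \<or> n mod nat M = nat (M - r)"
      by (simp only: neg_cong_iff cong_iff)
  qed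
  moreover have "n > 0" if "\<exists>r\<in>R. n mod nat M = nat r \<or> n mod nat M = nat (M - r)" for n
    using that R by (cases n) auto
  ultimately show ?thesis
    unfolding pm_residues_def by auto
qed

lemma euler_prod_pm_residues:
  fixes q :: "'a::{real_normed_field,banach}"
  assumes q: "norm q < 1" "q \<noteq> 0" and R: "R \<subseteq> {r. 0 < r \<and> 2 * r < M}"
  shows "euler_prod (pm_residues R M) q = (\<Prod>r\<in>R. theta_prod (q ^ nat M) (q ^ nat r))"
proof -
  let ?A = "\<lambda>r. {n. n mod nat M = nat r} \<union> {n. n mod nat M = nat (M - r)}"
  have "finite R"
    by (rule finite_subset[of _ "{0..M}"]) (use R in auto)
  moreover have "disjoint_family_on ?A R"
    unfolding disjoint_family_on_def
  proof (intro ballI impI)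
    fix r r' assume "r \<in> R" "r' \<in> R" "r \<noteq> r'"
    then have "0 < r" "2 * r < M" "0 < r'" "2 * r' < M"
      using R by auto
    with \<open>r \<noteq> r'\<close> show "?A r \<inter> ?A r' = {}"
      by auto
  qed
  moreover have "euler_prod (?A r) q = theta_prod (q ^ nat M) (q ^ nat r)" if "r \<in> R" for r
  proof -
    have r: "0 < r" "2 * r < M"
      using R that by auto
    then have "q ^ nat M / q ^ nat r = q ^ nat (M - r)"
      using q by (simp add: nat_diff_distrib power_diff)
    moreover have "{n. n mod nat M = nat r} \<inter> {n. n mod nat M = nat (M - r)} = {}"
      using r by auto
    moreover have "nat r < nat M" "nat (M - r) < nat M"
      using r by auto
    ultimately show ?thesis
      by (simp add: euler_prod_Un_disjoint euler_prod_residue_class theta_prod_def q)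
  qed
  ultimately show ?thesis
    unfolding pm_residues_eq_UN[OF R] by (simp add: euler_prod_UN_disjoint q)
qed

lemma prod_residue_theta:
  fixes q :: real
  assumes q: "0 < q" "q < 1" and R: "R \<subseteq> {r. 0 < r \<and> 2 * r < M}"
  shows "(\<Prod>r\<in>R. residue_theta q M r) =
    q powr (\<Sum>r\<in>R. theta_exponent (of_int M) (of_int r)) * euler_prod (pm_residues R M) q"
proof (cases "R = {}")
  case False
  then have "0 < M"
    using R by force
  then have "residue_theta q M r =
      q powr theta_exponent (of_int M) (of_int r) * theta_prod (q ^ nat M) (q ^ nat r)" if "r \<in> R" for r
    using R that q by (auto simp: residue_theta_def norm_theta_def powr_real_of_int)
  then show ?thesis
    using q R by (simp add: euler_prod_pm_residues powr_sum prod.distrib)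
qed (use q in \<open>simp add: pm_residues_def\<close>)

lemma powser_eq_0_imp_constant_coeff_0:
  fixes a :: "nat \<Rightarrow> real"
  assumes r: "0 < r" and zero: "\<And>x. 0 < x \<Longrightarrow> x < r \<Longrightarrow> (\<lambda>n. a n * x ^ n) sums 0"
  shows "a 0 = 0"
proof (rule tendsto_unique[OF trivial_limit_at_right_real])
  have "summable (\<lambda>n. a n * x ^ n)" if "norm x < r" for x
  proof -
    obtain y where y: "norm x < y" "y < r"
      using \<open>norm x < r\<close> dense by blast
    then have "0 < y"
      using norm_ge_zero[of x] by linarith
    from sums_summable[OF zero[OF this y(2)]] show ?thesis
      by (rule powser_inside) (use y \<open>0 < y\<close> in simp)
  qed
  then have "((\<lambda>x. \<Sum>n. a n * x ^ n) \<longlongrightarrow> a 0) (at 0)"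
    by (intro powser_limit_0[OF r]) (auto intro: summable_sums)
  then show "((\<lambda>x. \<Sum>n. a n * x ^ n) \<longlongrightarrow> a 0) (at_right 0)"
    by (rule tendsto_mono[OF at_le, rotated]) simp
  have "eventually (\<lambda>x. x \<in> {0<..<r}) (at_right 0)"
    using r by (rule eventually_at_right_real)
  then show "((\<lambda>x. \<Sum>n. a n * x ^ n) \<longlongrightarrow> 0) (at_right 0)"
    by (intro tendsto_eventually, eventually_elim) (use zero in \<open>auto simp: sums_iff\<close>)
qed

lemma powser_eq_0_imp_coeffs_0:
  fixes a :: "nat \<Rightarrow> real"
  assumes r: "0 < r" and zero: "\<And>x. 0 < x \<Longrightarrow> x < r \<Longrightarrow> (\<lambda>n. a n * x ^ n) sums 0"
  shows "a n = 0"
proof (induction n rule: less_induct)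
  case (less m)
  have "a (0 + m) = 0"
  proof (rule powser_eq_0_imp_constant_coeff_0[OF r])
    fix x assume x: "0 < x" "x < r"
    have "(\<lambda>n. a (n + m) * x ^ (n + m)) sums 0"
      using less by (subst sums_zero_iff_shift) (auto intro!: zero x)
    from sums_mult[OF this, of "1 / x ^ m"] show "(\<lambda>n. a (n + m) * x ^ n) sums 0"
      using x by (simp add: power_add)
  qed
  then show ?case
    by simp
qed

lemma partition_count_shift:
  assumes S: "0 \<notin> S" "0 \<notin> T"
    and identity: "\<And>q::real. 0 < q \<Longrightarrow> q < 1 \<Longrightarrow> 1 / euler_prod S q = q ^ k * (1 / euler_prod T q) + q ^ l"
  shows "partition_count S n =
    (if k \<le> n then partition_count T (n - k) else 0) + (if n = l then 1 else 0)"
proof -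
  define d where "d n = real (partition_count S n) -
    ((if k \<le> n then partition_count T (n - k) else 0) + (if n = l then 1 else 0))" for n
  have "d n = 0"
  proof (rule powser_eq_0_imp_coeffs_0[OF zero_less_one])
    fix q :: real assume q: "0 < q" "q < 1"
    have "(\<lambda>n. real (if k \<le> n then partition_count T (n - k) else 0) * q ^ n) =
        (\<lambda>n. if k \<le> n then q ^ k * (partition_count T (n - k) * q ^ (n - k)) else 0)"
      by (auto simp: fun_eq_iff simp flip: power_add)
    moreover have "(\<lambda>n. q ^ k * (partition_count T n * q ^ n)) sums (q ^ k * (1 / euler_prod T q))"
      using q S by (intro sums_mult partition_generating_function) auto
    ultimately have "(\<lambda>n. real (if k \<le> n then partition_count T (n - k) else 0) * q ^ n) sums
        (q ^ k * (1 / euler_prod T q))"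
      using sums_delayed[of k "\<lambda>n. q ^ k * (partition_count T n * q ^ n)"] by simp
    moreover have "(\<lambda>n. real (if n = l then 1 else 0) * q ^ n) = (\<lambda>n. if n = l then q ^ n else 0)"
      by auto
    then have "(\<lambda>n. real (if n = l then 1 else 0) * q ^ n) sums q ^ l"
      using sums_single[of l "\<lambda>n. q ^ n"] by simp
    moreover have "(\<lambda>n. real (partition_count S n) * q ^ n) sums (1 / euler_prod S q)"
      using q S by (intro partition_generating_function) auto
    ultimately have "(\<lambda>n. d n * q ^ n) sums
        (1 / euler_prod S q - (q ^ k * (1 / euler_prod T q) + q ^ l))"
      unfolding d_def of_nat_add left_diff_distrib distrib_right by (intro sums_diff sums_add)
    then show "(\<lambda>n. d n * q ^ n) sums 0"
      using identity[OF q] by simp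
  qed
  then show ?thesis
    by (auto simp: d_def split: if_splits)
qed

lemma partition_count_pm_residues_shift:
  fixes R R' :: "int set"
  assumes R: "R \<union> R' \<subseteq> {r. 0 < r \<and> 2 * r < M}"
    and identity: "\<And>q. 0 < q \<Longrightarrow> q < 1 \<Longrightarrow>
      1 / (\<Prod>r\<in>R. residue_theta q M r) -
      1 / (\<Prod>r\<in>R'. residue_theta q M r) = 1"
    and exponents: "(\<Sum>r\<in>R. theta_exponent (of_int M) (of_int r)) = real l"
      "(\<Sum>r\<in>R'. theta_exponent (of_int M) (of_int r)) = real l - real k"
  shows "partition_count (pm_residues R M) n =
    (if k \<le> n then partition_count (pm_residues R' M) (n - k) else 0) + (if n = l then 1 else 0)"
proof (rule partition_count_shift[OF zero_notin_pm_residues zero_notin_pm_residues])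
  fix q :: real assume q: "0 < q" "q < 1"
  let ?E = "euler_prod (pm_residues R M) q" and ?E' = "euler_prod (pm_residues R' M) q"
  have "1 / (q powr real l * ?E) - 1 / (q powr (real l - real k) * ?E') = 1"
    using identity[OF q] R by (simp add: prod_residue_theta q exponents)
  moreover have "q powr real l = q ^ l" "q powr (real l - real k) = q ^ l / q ^ k"
    using q by (simp_all add: powr_diff powr_realpow)
  moreover have "1 / ?E - q ^ k * (1 / ?E') = q ^ l * (1 / (q ^ l * ?E) - 1 / (q ^ l / q ^ k * ?E'))"
    using q by (simp add: right_diff_distrib)
  ultimately show "1 / ?E = q ^ k * (1 / ?E') + q ^ l"
    by (simp add: algebra_simps)
qed

subsection \<open>The partition identities\<close>

theorem reciprocal_residue_theta_identity:
  assumes "0 < q" "q < 1" "coprime k 42"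
  shows "1 / (\<Prod>r\<in>{1, 3, 4, 5, 7, 9, 11, 16, 17, 18, 19, 20}. residue_theta q 42 (k * r)) -
    1 / (\<Prod>r\<in>{1, 2, 3, 7, 8, 11, 13, 15, 17, 18, 19, 20}. residue_theta q 42 (k * r)) = 1"
proof -
  have "theta_mod_42 q k"
    using assms by unfold_locales auto
  then show ?thesis
    using theta_mod_42.reciprocal_identity[of q k] by (simp add: scaled_theta.\<theta>_def theta_mod_42_def)
qed

lemma partition_count_unit_multiple:
  assumes unit: "coprime k 42" and R: "R \<union> R' \<subseteq> {r. 0 < r \<and> 2 * r < 42}"
    and scaled: "\<And>q. residue_nome q 42 \<Longrightarrow>
      1 / (\<Prod>r\<in>{1, 3, 4, 5, 7, 9, 11, 16, 17, 18, 19, 20}. residue_theta q 42 (k * r)) -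
      1 / (\<Prod>r\<in>{1, 2, 3, 7, 8, 11, 13, 15, 17, 18, 19, 20}. residue_theta q 42 (k * r)) =
      1 / (\<Prod>r\<in>R. residue_theta q 42 r) - 1 / (\<Prod>r\<in>R'. residue_theta q 42 r)"
    and exponents: "(\<Sum>r\<in>R. theta_exponent 42 (of_int r)) = real l"
      "(\<Sum>r\<in>R'. theta_exponent 42 (of_int r)) = real l - real d"
    and index: "n = m + d" "n \<noteq> l"
  shows "partition_count (pm_residues R 42) n = partition_count (pm_residues R' 42) m"
proof -
  have "1 / (\<Prod>r\<in>R. residue_theta q 42 r) - 1 / (\<Prod>r\<in>R'. residue_theta q 42 r) = 1"
    if "0 < q" "q < 1" for q
    using reciprocal_residue_theta_identity[OF that unit] scaled[of q] that by (simp add: residue_nome_def)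
  from partition_count_pm_residues_shift[OF R this, of l d n] exponents index show ?thesis
    by simp
qed

lemmas unit_multiple_simps = residue_nome.residue_theta_reduce prime_imp_coprime theta_exponent_def mult_ac

theorem theorem5p3:
  shows "(\<forall>n\<ge>1.
      partition_count (pm_residues {1, 3, 4, 5, 7, 9, 11, 16, 17, 18, 19, 20} 42) n =
      partition_count (pm_residues {1, 2, 3, 7, 8, 11, 13, 15, 17, 18, 19, 20} 42) (n - 1)) \<and>
    (\<forall>n. n \<noteq> 2 \<longrightarrow>
      partition_count (pm_residues {1, 2, 5, 6, 7, 9, 10, 11, 13, 15, 16, 19} 42) n =
      partition_count (pm_residues {1, 3, 4, 5, 6, 7, 11, 13, 15, 16, 17, 20} 42) n) \<and>
    (\<forall>n. n \<noteq> 2 \<longrightarrow>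
      partition_count (pm_residues {1, 3, 4, 5, 7, 9, 10, 11, 12, 17, 19, 20} 42) n =
      partition_count (pm_residues {1, 2, 5, 7, 8, 9, 10, 11, 12, 13, 15, 19} 42) n) \<and>
    (\<forall>n\<ge>2.
      partition_count (pm_residues {2, 3, 5, 7, 8, 9, 10, 11, 13, 17, 18, 19} 42) n =
      partition_count (pm_residues {1, 3, 5, 7, 8, 11, 13, 15, 16, 17, 18, 20} 42) (n - 2)) \<and>
    (\<forall>n\<ge>3.
      partition_count (pm_residues {3, 4, 5, 7, 8, 9, 10, 11, 12, 13, 17, 19} 42) n =
      partition_count (pm_residues {1, 4, 5, 7, 9, 12, 13, 15, 16, 17, 19, 20} 42) (n - 3)) \<and>
    (\<forall>n. n \<noteq> 3 \<longrightarrow>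
      partition_count (pm_residues {1, 2, 4, 5, 6, 7, 9, 13, 15, 16, 17, 19} 42) n =
      partition_count (pm_residues {1, 2, 3, 6, 7, 8, 10, 11, 13, 15, 17, 19} 42) n)"
proof (intro conjI allI impI, goal_cases)
  case (1 n) show ?case
    by (rule partition_count_unit_multiple[where k = 1 and l = 0 and d = 1])
      (use 1 in \<open>simp_all add: unit_multiple_simps\<close>)
next
  case (2 n) show ?case
    by (rule partition_count_unit_multiple[where k = 5 and l = 2 and d = 0])
      (use 2 in \<open>simp_all add: unit_multiple_simps\<close>)
next
  case (3 n) show ?case
    by (rule partition_count_unit_multiple[where k = 11 and l = 2 and d = 0, symmetric])
      (use 3 in \<open>simp_all add: unit_multiple_simps\<close>)
next
  case (4 n) show ?case
    by (rule partition_count_unit_multiple[where k = 13 and l = 0 and d = 2])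
      (use 4 in \<open>simp_all add: unit_multiple_simps\<close>)
next
  case (5 n) show ?case
    by (rule partition_count_unit_multiple[where k = 17 and l = 0 and d = 3])
      (use 5 in \<open>simp_all add: unit_multiple_simps\<close>)
next
  case (6 n) show ?case
    by (rule partition_count_unit_multiple[where k = 19 and l = 3 and d = 0, symmetric])
      (use 6 in \<open>simp_all add: unit_multiple_simps\<close>)
qed

end
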